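(* Let $C$ be a proper cone in a Banach space $(X,\|\cdot\|)$, and assume that $C$ is a sup-semilattice in the partial ordering induced by $C$. Assume that $h:C\to C$ is continuous, homogeneous and order-preserving in the partial ordering from $C$, and that $\rho_C(h)<r_C(h)$. Then there exists $z\in C\setminus\{0\}$ such that $$h(z)\ge r_C(h)\,z.$$ If, in addition, there exists $\zeta\in C\setminus\{0\}$ such that (a) $h(\zeta)\ge r_C(h)\,\zeta$, and (b) the set $\{h^k(\zeta)/r_C(h)^k \mid k\ge 0\}$ is bounded, then $h(x)=r_C(h)\,x$ for some $x\in C\setminus\{0\}$, and, in particular, $\hat r_C(h)=r_C(h)$.
   Context: A subset $C$ of the real Banach space $X$ is a cone if $tC\subset C$ for all $t\ge 0$; it is proper if it is closed, convex and pointed ($C\cap(-C)=\{0\}$). A proper cone induces the partial order $x\le y\iff y-x\in C$. A subset $D\subset X$ is a sup-semilattice if for all $x,y\in D$ there is $z\in D$ with $x\le z$, $y\le z$, and $z\le w$ for every $w\in D$ with $x\le w$ and $y\le w$. A map $h:C\to C$ is homogeneous if $h(tx)=th(x)$ for all $t>0$, $x\in C$; it is order-preserving if $x\le y$ implies $h(x)\le h(y)$. $h^k$ is the $k$-th iterate. Cone spectral radius: $r_C(h)=\sup_{x\in C}\limsup_{k\to\infty}\|h^k(x)\|^{1/k}$. Cone eigenvalue spectral radius: $\hat r_C(h)=\sup\{\lambda\ge0\mid\exists x\in C\setminus\{0\},\ h(x)=\lambda x\}$ (supremum in $[0,+\infty]$). Fix a homogeneous generalized measure of noncompactness $\nu$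 on $X$, that is, a map $\nu$ from the bounded subsets of $X$ to $[0,\infty)$ such that, for all bounded $A,B\subset X$ and scalars $\lambda$: $\nu(A)=0$ iff $\operatorname{cl}A$ is compact; $\nu(A+B)\le\nu(A)+\nu(B)$; $\nu(\operatorname{cl}\operatorname{conv}A)=\nu(A)$; $\nu(\lambda A)=|\lambda|\nu(A)$; $A\subset B$ implies $\nu(A)\le\nu(B)$. Set $\nu_C(h)=\inf\{\lambda>0\mid \nu(h(A))\le\lambda\nu(A)\text{ for all bounded }A\subset C\}$. The cone essential spectral radius is $\rho_C(h)=\lim_{k\to\infty}\nu_C(h^k)^{1/k}=\inf_{k\ge1}\nu_C(h^k)^{1/k}$. *)

theory Defs
  imports "HOL-Analysis.Analysis"
begin

definition proper_cone :: "'a::real_normed_vector set \<Rightarrow> bool" where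
  "proper_cone C \<longleftrightarrow> cone C \<and> closed C \<and> convex C \<and> C \<inter> uminus ` C = {0}"

definition cone_le :: "'a::real_vector set \<Rightarrow> 'a \<Rightarrow> 'a \<Rightarrow> bool" where
  "cone_le C x y \<longleftrightarrow> y - x \<in> C"

definition sup_semilattice_in_cone_order :: "'a::real_vector set \<Rightarrow> 'a set \<Rightarrow> bool" where
  "sup_semilattice_in_cone_order C D \<longleftrightarrow>
     (\<forall>x\<in>D. \<forall>y\<in>D. \<exists>z\<in>D. cone_le C x z \<and> cone_le C y z \<and>
        (\<forall>w\<in>D. cone_le C x w \<and> cone_le C y w \<longrightarrow> cone_le C z w))"

definition homogeneous_on :: "'a::real_vector set \<Rightarrow> ('a \<Rightarrow> 'a) \<Rightarrow> bool" where
  "homogeneous_on C h \<longleftrightarrow> (\<forall>x\<in>C. \<forall>t>0. h (t *\<^sub>R x) = t *\<^sub>R h x)"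

definition cone_order_preserving :: "'a::real_vector set \<Rightarrow> ('a \<Rightarrow> 'a) \<Rightarrow> bool" where
  "cone_order_preserving C h \<longleftrightarrow>
     (\<forall>x\<in>C. \<forall>y\<in>C. cone_le C x y \<longrightarrow> cone_le C (h x) (h y))"

(* The spectral radii are suprema or infima in [0, infinity], hence of type ennreal;
   there the supremum of the empty set is 0 and the infimum of the empty set is infinity.
   The term k = 0 of the sequence below is irrelevant to the limsup. *)
definition cone_spectral_radius :: "'a::real_normed_vector set \<Rightarrow> ('a \<Rightarrow> 'a) \<Rightarrow> ennreal" where
  "cone_spectral_radius C h =
     (SUP x\<in>C. limsup (\<lambda>k. ennreal (root k (norm ((h ^^ k) x)))))"

definition cone_eigenvalue_spectral_radius ::
    "'a::real_normed_vector set \<Rightarrow> ('a \<Rightarrow> 'a) \<Rightarrow> ennreal" where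
  "cone_eigenvalue_spectral_radius C h =
     Sup {ennreal \<mu> | \<mu>. 0 \<le> \<mu> \<and> (\<exists>x\<in>C - {0}. h x = \<mu> *\<^sub>R x)}"

(* A homogeneous generalized measure of noncompactness is a function of bounded sets only:
   its values on unbounded sets are unconstrained and never used. *)
definition homogeneous_generalized_mnc :: "('a::real_normed_vector set \<Rightarrow> real) \<Rightarrow> bool" where
  "homogeneous_generalized_mnc \<nu> \<longleftrightarrow>
     (\<forall>A. bounded A \<longrightarrow> 0 \<le> \<nu> A) \<and>
     (\<forall>A. bounded A \<longrightarrow> (\<nu> A = 0 \<longleftrightarrow> compact (closure A))) \<and>
     (\<forall>A B. bounded A \<and> bounded B \<longrightarrow> \<nu> {a + b | a b. a \<in> A \<and> b \<in> B} \<le> \<nu> A + \<nu> B) \<and>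
     (\<forall>A. bounded A \<longrightarrow> \<nu> (closure (convex hull A)) = \<nu> A) \<and>
     (\<forall>A c. bounded A \<longrightarrow> \<nu> ((\<lambda>x. c *\<^sub>R x) ` A) = \<bar>c\<bar> * \<nu> A) \<and>
     (\<forall>A B. bounded B \<and> A \<subseteq> B \<longrightarrow> \<nu> A \<le> \<nu> B)"

definition mnc_constant ::
    "('a::real_normed_vector set \<Rightarrow> real) \<Rightarrow> 'a set \<Rightarrow> ('a \<Rightarrow> 'a) \<Rightarrow> ennreal" where
  "mnc_constant \<nu> C h =
     Inf {ennreal \<mu> | \<mu>. 0 < \<mu> \<and> (\<forall>A. bounded A \<and> A \<subseteq> C \<longrightarrow> \<nu> (h ` A) \<le> \<mu> * \<nu> A)}"

definition ennreal_root :: "nat \<Rightarrow> ennreal \<Rightarrow> ennreal" where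
  "ennreal_root k x = (if x = top then top else ennreal (root k (enn2real x)))"

(* The infimum equals the limit of the same sequence, by submultiplicativity, whenever
   mnc_constant \<nu> C h is finite; the infimum also makes sense when it is not. *)
definition cone_essential_spectral_radius ::
    "('a::real_normed_vector set \<Rightarrow> real) \<Rightarrow> 'a set \<Rightarrow> ('a \<Rightarrow> 'a) \<Rightarrow> ennreal" where
  "cone_essential_spectral_radius \<nu> C h =
     (INF k\<in>{1..}. ennreal_root k (mnc_constant \<nu> C (h ^^ k)))"

(* Hence enn2real (cone_spectral_radius C h) is the genuine value for the maps considered. *)
lemma cone_spectral_radius_finite:
  fixes C :: "'a::real_normed_vector set"
  assumes C: "proper_cone C" and h: "h \<in> C \<rightarrow> C" "continuous_on C h" "homogeneous_on C h"
  shows "cone_spectral_radius C h < top"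
proof -
  have 0: "0 \<in> C" and cone: "\<And>x c. x \<in> C \<Longrightarrow> 0 \<le> c \<Longrightarrow> c *\<^sub>R x \<in> C"
    using C by (auto simp: proper_cone_def cone_def)
  have hom: "\<And>x t. x \<in> C \<Longrightarrow> 0 < t \<Longrightarrow> h (t *\<^sub>R x) = t *\<^sub>R h x"
    using h(3) by (auto simp: homogeneous_on_def)
  have h0: "h 0 = 0"
    using hom[OF 0, of 2] by (simp add: scaleR_2)
  obtain d where d: "0 < d" "\<And>x. x \<in> C \<Longrightarrow> norm x < d \<Longrightarrow> norm (h x) < 1"
    using h(2) 0 h0 unfolding continuous_on_iff dist_norm by (metis diff_zero zero_less_one)
  define M where "M = 2 / d"
  have M: "0 < M" using d by (simp add: M_def)
  have bd: "norm (h x) \<le> M * norm x" if x: "x \<in> C" for x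
  proof (cases "x = 0")
    case False
    define t where "t = d / (2 * norm x)"
    have t: "0 < t" using d False by (simp add: t_def)
    have "norm (t *\<^sub>R x) < d" using d False by (simp add: t_def)
    then have "norm (h (t *\<^sub>R x)) < 1" using d(2) cone x t by simp
    then have "t * norm (h x) < 1" using hom[OF x t] t by simp
    then show ?thesis using False d by (simp add: t_def M_def field_simps)
  qed (simp add: h0)
  have it: "(h ^^ k) x \<in> C \<and> norm ((h ^^ k) x) \<le> M ^ k * norm x" if x: "x \<in> C" for x k
  proof (induction k)
    case (Suc k)
    have "norm (h ((h ^^ k) x)) \<le> M * norm ((h ^^ k) x)" using Suc bd by blast
    also have "\<dots> \<le> M * (M ^ k * norm x)" using Suc M by simp
    finally show ?case using Suc h(1) by (auto simp: mult.assoc)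
  qed (use x in simp)
  have "limsup (\<lambda>k. ennreal (root k (norm ((h ^^ k) x)))) \<le> ennreal M" if x: "x \<in> C" for x
  proof -
    define c where "c = norm x + 1"
    have c: "0 < c" unfolding c_def by (smt (verit) norm_ge_zero)
    have "(\<lambda>k. ennreal (M * root k c)) \<longlonglongrightarrow> ennreal (M * 1)"
      by (intro tendsto_intros LIMSEQ_root_const c)
    then have lim: "limsup (\<lambda>k. ennreal (M * root k c)) = ennreal M"
      by (simp add: lim_imp_Limsup)
    have "root k (norm ((h ^^ k) x)) \<le> M * root k c" if k: "0 < k" for k
    proof -
      have "norm ((h ^^ k) x) \<le> M ^ k * c"
        using it[OF x, of k] M unfolding c_def by (smt (verit) mult_left_mono zero_le_power)
      then have "root k (norm ((h ^^ k) x)) \<le> root k (M ^ k * c)" using k by simp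
      also have "\<dots> = M * root k c" using k M by (simp add: real_root_mult real_root_power_cancel)
      finally show ?thesis .
    qed
    then have "limsup (\<lambda>k. ennreal (root k (norm ((h ^^ k) x)))) \<le> limsup (\<lambda>k. ennreal (M * root k c))"
      by (intro Limsup_mono eventually_mono[OF eventually_gt_at_top[of 0]] ennreal_leI) auto
    then show ?thesis by (simp add: lim)
  qed
  then have "cone_spectral_radius C h \<le> ennreal M"
    unfolding cone_spectral_radius_def by (rule SUP_least)
  then show ?thesis using ennreal_less_top le_less_trans by blast
qed

end

theory Submission
  imports Defs
begin

text \<open>
  Let $r$ be the cone spectral radius. Some iterate $f = h^m$ multiplies the measure of
  noncompactness by a factor $\mu < r^m$. For $\mu < L < r^m$ choose $u$ in the cone whose orbit
  under $f / L$ is unbounded. Darbo's fixed point theorem, applied to the radial retraction to the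
  unit ball of $y \mapsto f(y) / L + t u$, yields either a unit vector $y$ with
  $f(y) / L + t u = s y$ and $s \ge 1$, or a fixed point of $y \mapsto f(y) / L + t u$. A fixed
  point would majorize $t (f / L)^k u$ for every $k$; normalizing along record values of the norm
  and passing to a limit, which exists by noncompactness estimates and not by normality of the
  cone, contradicts pointedness. Letting $t \to 0$ and $L \to r^m$ gives $f(x) \ge r^m x$ with
  $x \ne 0$, and the supremum $z$ of $h^j(x) / r^j$ over $j < m$ satisfies $h(z) \ge r z$.
  For the second part, the increasing orbit of $\zeta$ under $h / r$ is relatively compact, hence
  converges, and its limit is an eigenvector.
\<close>

subsection \<open>Brouwer's and Schauder's fixed point theorems\<close>

lemma tendsto_coordI:
  fixes f :: "'b \<Rightarrow> 'i \<Rightarrow> 'c::topological_space"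
  assumes "\<And>i. ((\<lambda>x. f x i) \<longlongrightarrow> l i) F"
  shows "(f \<longlongrightarrow> l) F"
  using assms unfolding limitin_canonical_iff[symmetric] euclidean_product_topology[symmetric]
  by (simp add: limitin_componentwise)

lemma tendsto_coordD:
  fixes f :: "'b \<Rightarrow> 'i \<Rightarrow> 'c::topological_space"
  assumes "(f \<longlongrightarrow> l) F"
  shows "((\<lambda>x. f x i) \<longlongrightarrow> l i) F"
  using assms unfolding limitin_canonical_iff[symmetric] euclidean_product_topology[symmetric]
  by (simp add: limitin_componentwise)

text \<open>Brouwer's theorem with the dimension \<open>n\<close> as a number instead of a type: the
  cube sits in \<open>nat \<Rightarrow> real\<close>, all coordinates from \<open>n\<close> on being
  0, and is compact by Tychonoff. On the grid of mesh \<open>1 / Suc p\<close>, Kuhn's combinatorial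
  lemma finds a cell in which, for each coordinate, \<open>T\<close> does not decrease that
  coordinate at one vertex and does not increase it at another. A limit of such cells is a fixed
  point.\<close>

lemma brouwer_nat_cube:
  fixes T :: "(nat \<Rightarrow> real) \<Rightarrow> nat \<Rightarrow> real" and n :: nat
  defines "K \<equiv> {x. \<forall>i. x i \<in> {0..(if i < n then 1 else 0)}}"
  assumes cont: "\<And>i. i < n \<Longrightarrow> continuous_on K (\<lambda>x. T x i)"
    and range: "\<And>x i. x \<in> K \<Longrightarrow> i < n \<Longrightarrow> T x i \<in> {0..1}"
  obtains x where "x \<in> K" "\<And>i. i < n \<Longrightarrow> T x i = x i"
proof -
  define g where "g p a = (\<lambda>i. if i < n then real (a i) / real (Suc p) else 0)" for p :: nat and a :: "nat \<Rightarrow> nat"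
  have gK: "g p a \<in> K" if "\<And>i. i < n \<Longrightarrow> a i \<le> Suc p" for p a
    using that by (auto simp: g_def K_def simp del: of_nat_Suc)
  have "\<exists>a. (\<forall>i<n. a i < Suc p) \<and> (\<forall>i<n. \<exists>b c.
      (\<forall>j<n. a j \<le> b j \<and> b j \<le> a j + 1) \<and> (\<forall>j<n. a j \<le> c j \<and> c j \<le> a j + 1) \<and>
      g p b i \<le> T (g p b) i \<and> T (g p c) i \<le> g p c i)" for p
  proof -
    \<comment> \<open>Label 0 means that coordinate \<open>i\<close> does not decrease. Kuhn's lemma
      wants label 0 on the face \<open>a i = 0\<close> and label 1 on the face
      \<open>a i = Suc p\<close>; since \<open>T\<close> has values in \<open>{0..1}\<close>, these
      forced labels still tell the truth, which is what \<open>l0\<close> and \<open>l1\<close>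
      record.\<close>
    define label where "label a i = (if a i = 0 \<or> a i < Suc p \<and> g p a i \<le> T (g p a) i then 0 else 1 :: nat)"
      for a :: "nat \<Rightarrow> nat" and i
    have l0: "g p a i \<le> T (g p a) i" if "label a i = 0" "i < n" "\<And>i. i < n \<Longrightarrow> a i \<le> Suc p" for a i
      using range[OF gK[OF that(3)] that(2)] that(1,2)
      by (auto simp: label_def g_def split: if_splits)
    have l1: "T (g p a) i \<le> g p a i" if "label a i = 1" "i < n" "\<And>i. i < n \<Longrightarrow> a i \<le> Suc p" for a i
      using range[OF gK[OF that(3)] that(2)] that(1,2) that(3)[of i]
      by (auto simp: label_def g_def split: if_splits)
    have l01: "label a i = 0 \<or> label a i = 1" for a i
      by (simp add: label_def)
    obtain q where q: "\<forall>i<n. q i < Suc p"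
      "\<forall>i<n. \<exists>r s. (\<forall>j<n. q j \<le> r j \<and> r j \<le> q j + 1) \<and> (\<forall>j<n. q j \<le> s j \<and> s j \<le> q j + 1) \<and> label r i \<noteq> label s i"
      by (rule kuhn_lemma[of "Suc p" n label]) (auto simp: label_def)
    have "\<exists>b c. (\<forall>j<n. q j \<le> b j \<and> b j \<le> q j + 1) \<and> (\<forall>j<n. q j \<le> c j \<and> c j \<le> q j + 1) \<and>
      g p b i \<le> T (g p b) i \<and> T (g p c) i \<le> g p c i" if i: "i < n" for i
    proof -
      obtain r s where rs: "\<forall>j<n. q j \<le> r j \<and> r j \<le> q j + 1" "\<forall>j<n. q j \<le> s j \<and> s j \<le> q j + 1"
        "label r i \<noteq> label s i"
        using q(2) i by blast
      have r: "\<And>j. j < n \<Longrightarrow> r j \<le> Suc p" and s: "\<And>j. j < n \<Longrightarrow> s j \<le> Suc p"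
        using q(1) rs by (fastforce dest: spec)+
      consider "label r i = 0" "label s i = 1" | "label s i = 0" "label r i = 1"
        using rs(3) l01[of r i] l01[of s i] by auto
      then show ?thesis
        by cases (use l0 l1 r s i rs in blast)+
    qed
    then show ?thesis using q(1) by blast
  qed
  then obtain a where a: "\<And>p i. i < n \<Longrightarrow> a p i < Suc p"
    "\<And>p i. i < n \<Longrightarrow> \<exists>b c.
      (\<forall>j<n. a p j \<le> b j \<and> b j \<le> a p j + 1) \<and> (\<forall>j<n. a p j \<le> c j \<and> c j \<le> a p j + 1) \<and>
      g p b i \<le> T (g p b) i \<and> T (g p c) i \<le> g p c i"
    by metis
  have "compact K"
  proof -
    have "K = Pi\<^sub>E UNIV (\<lambda>i. {0..(if i < n then 1 else 0)})"
      unfolding K_def by (simp add: PiE_UNIV_domain Pi_def)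
    then have "compactin (product_topology (\<lambda>i. euclidean) UNIV) K"
      by (simp add: compactin_PiE)
    then show ?thesis
      by (simp add: euclidean_product_topology)
  qed
  moreover have "\<forall>p. g p (a p) \<in> K"
    using gK a(1) by (metis less_imp_le)
  ultimately obtain x \<sigma> where x: "x \<in> K" and \<sigma>: "strict_mono \<sigma>" "((\<lambda>p. g p (a p)) \<circ> \<sigma>) \<longlonglongrightarrow> x"
    unfolding compact_eq_seq_compact_metric seq_compact_def by meson
  \<comment> \<open>Any choice of vertices, one from each cell, has the same limit along
    \<open>\<sigma>\<close> as the corners, because vertices of one cell differ by at most the mesh
    in each coordinate.\<close>
  have near: "(\<lambda>p. g (\<sigma> p) (b (\<sigma> p))) \<longlonglongrightarrow> x"
    if b: "\<forall>p. \<forall>j<n. a p j \<le> b p j \<and> b p j \<le> a p j + 1" for b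
  proof (rule tendsto_coordI)
    fix i
    have "(\<lambda>p. g (\<sigma> p) (a (\<sigma> p)) i) \<longlonglongrightarrow> x i"
      using tendsto_coordD[OF \<sigma>(2)] by (simp add: o_def)
    moreover have "(\<lambda>p. g (\<sigma> p) (b (\<sigma> p)) i - g (\<sigma> p) (a (\<sigma> p)) i) \<longlonglongrightarrow> 0"
    proof (rule Lim_null_comparison)
      show "\<forall>\<^sub>F p in sequentially. norm (g (\<sigma> p) (b (\<sigma> p)) i - g (\<sigma> p) (a (\<sigma> p)) i) \<le> inverse (real (Suc (\<sigma> p)))"
      proof (rule always_eventually, rule allI)
        fix p
        show "norm (g (\<sigma> p) (b (\<sigma> p)) i - g (\<sigma> p) (a (\<sigma> p)) i) \<le> inverse (real (Suc (\<sigma> p)))"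
        proof (cases "i < n")
          case True
          then have "\<bar>real (b (\<sigma> p) i) - real (a (\<sigma> p) i)\<bar> \<le> 1"
            using b by (smt (verit) of_nat_1 of_nat_add of_nat_mono)
          with True show ?thesis
            by (simp add: g_def divide_simps flip: diff_divide_distrib)
        qed (simp add: g_def)
      qed
      show "(\<lambda>p. inverse (real (Suc (\<sigma> p)))) \<longlonglongrightarrow> 0"
        using LIMSEQ_subseq_LIMSEQ[OF LIMSEQ_inverse_real_of_nat \<sigma>(1)] by (simp add: o_def)
    qed
    ultimately have "(\<lambda>p. g (\<sigma> p) (b (\<sigma> p)) i - g (\<sigma> p) (a (\<sigma> p)) i + g (\<sigma> p) (a (\<sigma> p)) i) \<longlonglongrightarrow> 0 + x i"
      by (intro tendsto_add)
    then show "(\<lambda>p. g (\<sigma> p) (b (\<sigma> p)) i) \<longlonglongrightarrow> x i"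
      by simp
  qed
  have lim: "(\<lambda>p. T (g (\<sigma> p) (b (\<sigma> p))) i - g (\<sigma> p) (b (\<sigma> p)) i) \<longlonglongrightarrow> T x i - x i"
    if i: "i < n" and b: "\<forall>p. \<forall>j<n. a p j \<le> b p j \<and> b p j \<le> a p j + 1" for b i
  proof (rule tendsto_diff)
    have "g (\<sigma> p) (b (\<sigma> p)) \<in> K" for p
    proof (rule gK)
      fix j assume "j < n"
      then show "b (\<sigma> p) j \<le> Suc (\<sigma> p)"
        using b a(1)[of j "\<sigma> p"] by (metis Suc_eq_plus1 Suc_leI add_le_mono1 le_trans less_Suc_eq_le)
    qed
    then show "(\<lambda>p. T (g (\<sigma> p) (b (\<sigma> p))) i) \<longlonglongrightarrow> T x i"
      by (intro continuous_on_tendsto_compose[OF cont[OF i] near[OF b] x]) auto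
    show "(\<lambda>p. g (\<sigma> p) (b (\<sigma> p)) i) \<longlonglongrightarrow> x i"
      using tendsto_coordD[OF near[OF b]] .
  qed
  have "T x i = x i" if i: "i < n" for i
  proof -
    \<comment> \<open>The vertices \<open>b p\<close> and \<open>c p\<close> witness the two
      opposite inequalities for coordinate \<open>i\<close>; both sequences converge to
      \<open>x\<close>.\<close>
    obtain b c where bc:
      "\<forall>p. \<forall>j<n. a p j \<le> b p j \<and> b p j \<le> a p j + 1" "\<forall>p. \<forall>j<n. a p j \<le> c p j \<and> c p j \<le> a p j + 1"
      "\<forall>p. g p (b p) i \<le> T (g p (b p)) i" "\<forall>p. T (g p (c p)) i \<le> g p (c p) i"
      using a(2)[OF i] by metis
    have "0 \<le> T x i - x i"
      by (rule LIMSEQ_le_const[OF lim[OF i bc(1)]]) (use bc(3) in auto)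
    moreover have "T x i - x i \<le> 0"
      by (rule LIMSEQ_le_const2[OF lim[OF i bc(2)]]) (use bc(4) in auto)
    ultimately show ?thesis by simp
  qed
  then show thesis using that x by blast
qed

text \<open>By compactness it is enough to find points moved by at most \<open>e\<close>. The
  Schauder projection onto the hull of a finite \<open>e\<close>-net replaces \<open>f\<close> by a
  self-map of a cube of weights, to which Brouwer's theorem applies.\<close>

theorem schauder_fixed_point:
  fixes S :: "'a::real_normed_vector set"
  assumes S: "compact S" "convex S" "S \<noteq> {}" and contf: "continuous_on S f" and fS: "f \<in> S \<rightarrow> S"
  obtains x where "x \<in> S" "f x = x"
proof -
  have approx: "\<exists>x\<in>S. norm (f x - x) \<le> e" if e: "e > 0" for e
  proof -
    obtain N where N: "finite N" "N \<subseteq> S" "S \<subseteq> (\<Union>x\<in>N. ball x e)"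
      using compactE_image[OF S(1), of S "\<lambda>x. ball x e"] e
      by (smt (verit, best) UN_iff centre_in_ball open_ball subsetI)
    obtain n v where v: "N = v ` {i. i < (n::nat)}"
      using N(1) finite_imp_nat_seg_image_inj_on by metis
    have vS: "v i \<in> S" if "i < n" for i using that N v by auto
    have "n \<noteq> 0" using S(3) N(3) v by auto
    then have v0: "v 0 \<in> S" using vS by auto
    \<comment> \<open>Unnormalized partition of unity: \<open>\<phi> i\<close> is positive exactly
      on the ball of radius \<open>e\<close> around \<open>v i\<close>.\<close>
    define \<phi> where "\<phi> i y = max 0 (e - norm (v i - y))" for i y
    have \<phi>0: "0 \<le> \<phi> i y" for i y by (simp add: \<phi>_def)
    have \<phi>pos: "0 < (\<Sum>i<n. \<phi> i y)" if y: "y \<in> S" for y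
    proof -
      obtain i where "i < n" "dist (v i) y < e" using y N(3) v by (auto simp: subset_iff)
      then have "0 < \<phi> i y" by (simp add: \<phi>_def dist_norm)
      then show ?thesis using \<open>i < n\<close> \<phi>0 by (intro sum_pos2) auto
    qed
    define K :: "(nat \<Rightarrow> real) set" where "K = {x. \<forall>i. x i \<in> {0..(if i < n then 1 else 0)}}"
    \<comment> \<open>\<open>P\<close> extends the convex combination of the net points from the
      simplex to the whole cube: a total weight below 1 is completed by extra weight on
      \<open>v 0\<close>, a total above 1 is divided out. On weights of sum 1 it is the plain
      combination.\<close>
    define D where "D t = max 1 (\<Sum>i<n. t i)" for t :: "nat \<Rightarrow> real"
    define P where "P t = (1 / D t) *\<^sub>R ((\<Sum>i<n. t i *\<^sub>R v i) + (D t - (\<Sum>i<n. t i)) *\<^sub>R v 0)" for t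
    have D1: "1 \<le> D t" for t by (simp add: D_def)
    have coneS: "(\<Sum>i<n. t i *\<^sub>R v i) + s *\<^sub>R v 0 \<in> (\<lambda>y. ((\<Sum>i<n. t i) + s) *\<^sub>R y) ` S"
      if "\<And>i. i < n \<Longrightarrow> 0 \<le> t i" "0 \<le> s" "0 < (\<Sum>i<n. t i) + s" for t s
    proof -
      define c where "c = (\<Sum>i<n. t i) + s"
      \<comment> \<open>The index \<open>n\<close> carries a second copy of \<open>v 0\<close>, so
        that its extra weight need not be merged with the coefficient of index 0.\<close>
      define w where "w j = (if j < n then t j / c else s / c)" for j
      define p where "p j = (if j < n then v j else v 0)" for j
      have c: "c > 0" using that c_def by simp
      have "(\<Sum>j\<in>{..n}. w j *\<^sub>R p j) \<in> S"
      proof (rule convex_sum)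
        show "sum w {..n} = 1"
          using c by (simp add: lessThan_Suc_atMost[symmetric] w_def sum_divide_distrib[symmetric])
            (simp add: c_def add_divide_distrib[symmetric])
      qed (use S that vS v0 c in \<open>auto simp: w_def p_def\<close>)
      moreover have "c *\<^sub>R (\<Sum>j\<in>{..n}. w j *\<^sub>R p j) = (\<Sum>i<n. t i *\<^sub>R v i) + s *\<^sub>R v 0"
        using c by (simp add: lessThan_Suc_atMost[symmetric] w_def p_def scaleR_add_right scaleR_sum_right)
      ultimately show ?thesis unfolding c_def[symmetric] by (intro image_eqI) (rule sym)
    qed
    have PS: "P t \<in> S" if "t \<in> K" for t
    proof -
      have "0 \<le> t i" for i using that by (auto simp: K_def)
      then have "(\<Sum>i<n. t i *\<^sub>R v i) + (D t - (\<Sum>i<n. t i)) *\<^sub>R v 0 \<in> (\<lambda>y. D t *\<^sub>R y) ` S"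
        using coneS[of t "D t - (\<Sum>i<n. t i)"] D1[of t] by (simp add: D_def)
      then show ?thesis using D1[of t] by (auto simp: P_def)
    qed
    have contP: "continuous_on K P"
    proof -
      have c: "continuous_on K (\<lambda>t. t i)" for i :: nat
        by (rule continuous_on_product_then_coordinatewise) (rule continuous_on_id)
      show ?thesis unfolding P_def D_def by (intro continuous_intros c) auto
    qed
    define T where "T t i = \<phi> i (f (P t)) / (\<Sum>j<n. \<phi> j (f (P t)))" for t i
    have fP: "f (P t) \<in> S" if "t \<in> K" for t using PS[OF that] fS by auto
    obtain t where t: "t \<in> K" "\<And>i. i < n \<Longrightarrow> T t i = t i"
    proof (rule brouwer_nat_cube[where T = T and n = n, folded K_def])
      show "continuous_on K (\<lambda>t. T t i)" if "i < n" for i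
      proof -
        have "continuous_on K (\<lambda>t. f (P t))"
          by (rule continuous_on_compose2[OF contf contP]) (use PS in auto)
        then show ?thesis unfolding T_def \<phi>_def
          using \<phi>pos[OF fP, unfolded \<phi>_def] by (intro continuous_intros) force+
      qed
      show "T t i \<in> {0..1}" if "t \<in> K" "i < n" for t i
      proof -
        have "\<phi> i (f (P t)) \<le> (\<Sum>j<n. \<phi> j (f (P t)))"
          using that \<phi>0 by (intro member_le_sum) auto
        then show ?thesis using \<phi>pos[OF fP[OF that(1)]] \<phi>0 by (simp add: T_def)
      qed
    qed auto
    define y where "y = f (P t)"
    define s where "s = (\<Sum>j<n. \<phi> j y)"
    have s: "s > 0" using \<phi>pos fP[OF t(1)] by (simp add: s_def y_def)
    have ti: "t i = \<phi> i y / s" if "i < n" for i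
      using t(2)[OF that] by (simp add: T_def y_def s_def)
    \<comment> \<open>The fixed weights are normalized bumps at \<open>y = f (P t)\<close>. They sum
      to 1 and charge only net points within \<open>e\<close> of \<open>y\<close>, hence
      \<open>P t\<close> is within \<open>e\<close> of \<open>y\<close>.\<close>
    have sum1: "(\<Sum>i<n. t i) = 1"
      using s by (simp add: ti s_def sum_divide_distrib[symmetric])
    then have "P t = (\<Sum>i<n. t i *\<^sub>R v i)"
      by (simp add: P_def D_def)
    then have "norm (y - P t) = norm (\<Sum>i<n. t i *\<^sub>R (y - v i))"
      by (simp add: scaleR_diff_right sum_subtractf flip: scaleR_left.sum) (simp add: sum1)
    also have "\<dots> \<le> (\<Sum>i<n. t i * e)"
    proof (rule sum_norm_le)
      fix i assume "i \<in> {..<n}"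
      then have i: "i < n" by simp
      show "norm (t i *\<^sub>R (y - v i)) \<le> t i * e"
      proof (cases "\<phi> i y = 0")
        case False
        then have "norm (y - v i) \<le> e" by (auto simp: \<phi>_def norm_minus_commute split: if_splits)
        moreover have "0 \<le> t i" using ti[OF i] \<phi>0 s by simp
        ultimately show ?thesis by (simp add: mult_left_mono)
      qed (simp add: ti[OF i])
    qed
    also have "\<dots> = e" using sum1 by (simp add: sum_distrib_right[symmetric])
    finally show ?thesis using PS[OF t(1)] by (auto simp: y_def)
  qed
  have "\<exists>x\<in>S. norm (f x - x) \<le> inverse (real (Suc k))" for k
    by (rule approx) simp
  then obtain x where x: "\<And>k. x k \<in> S" "\<And>k. norm (f (x k) - x k) \<le> inverse (real (Suc k))"
    by metis
  obtain l \<sigma> where l: "l \<in> S" "strict_mono \<sigma>" "(x \<circ> \<sigma>) \<longlonglongrightarrow> l"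
    using S(1) x(1) unfolding compact_eq_seq_compact_metric seq_compact_def by metis
  have lx: "(\<lambda>k. x (\<sigma> k)) \<longlonglongrightarrow> l" using l(3) by (simp add: o_def)
  have "(\<lambda>k. f (x (\<sigma> k)) - x (\<sigma> k)) \<longlonglongrightarrow> f l - l"
    by (intro tendsto_diff lx continuous_on_tendsto_compose[OF contf lx l(1)]) (use x in auto)
  moreover have "(\<lambda>k. f (x (\<sigma> k)) - x (\<sigma> k)) \<longlonglongrightarrow> 0"
    by (rule Lim_null_comparison[where g = "\<lambda>k. inverse (real (Suc (\<sigma> k)))"])
      (use x(2) LIMSEQ_subseq_LIMSEQ[OF LIMSEQ_inverse_real_of_nat l(2)] in \<open>auto simp: o_def\<close>)
  ultimately have "f l - l = 0" by (rule LIMSEQ_unique)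
  then show thesis using that l(1) by simp
qed

subsection \<open>Measures of noncompactness\<close>

lemma bounded_set_sum:
  fixes A B :: "'a::real_normed_vector set"
  assumes "bounded A" "bounded B"
  shows "bounded {a + b | a b. a \<in> A \<and> b \<in> B}"
  by (rule bounded_subset[OF bounded_sums[OF assms]]) auto

context
  fixes \<nu> :: "'a::real_normed_vector set \<Rightarrow> real"
  assumes \<nu>: "homogeneous_generalized_mnc \<nu>"
begin

lemma mnc_nonneg: "bounded A \<Longrightarrow> 0 \<le> \<nu> A"
  and mnc_eq_0_iff: "bounded A \<Longrightarrow> \<nu> A = 0 \<longleftrightarrow> compact (closure A)"
  and mnc_sum_le: "bounded A \<Longrightarrow> bounded B \<Longrightarrow> \<nu> {a + b | a b. a \<in> A \<and> b \<in> B} \<le> \<nu> A + \<nu> B"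
  and mnc_closed_convex_hull: "bounded A \<Longrightarrow> \<nu> (closure (convex hull A)) = \<nu> A"
  and mnc_scaleR: "bounded A \<Longrightarrow> \<nu> ((\<lambda>x. c *\<^sub>R x) ` A) = \<bar>c\<bar> * \<nu> A"
  and mnc_mono: "bounded B \<Longrightarrow> A \<subseteq> B \<Longrightarrow> \<nu> A \<le> \<nu> B"
  using \<nu> by (simp_all add: homogeneous_generalized_mnc_def)

lemma mnc_compact: "compact K \<Longrightarrow> \<nu> K = 0"
  using mnc_eq_0_iff[OF compact_imp_bounded, of K] compact_imp_closed[of K] by simp

lemma mnc_convex_hull_le:
  assumes "bounded A" shows "\<nu> (convex hull A) \<le> \<nu> A"
  using mnc_mono[OF bounded_closure[OF bounded_convex_hull[OF assms]] closure_subset]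
  by (simp add: mnc_closed_convex_hull assms)

lemma mnc_compact_add_le:
  assumes "compact K" "bounded B" "A \<subseteq> {a + b | a b. a \<in> K \<and> b \<in> B}"
  shows "\<nu> A \<le> \<nu> B"
proof -
  have "\<nu> A \<le> \<nu> {a + b | a b. a \<in> K \<and> b \<in> B}"
    by (rule mnc_mono[OF bounded_set_sum[OF compact_imp_bounded[OF assms(1)] assms(2)] assms(3)])
  also have "\<dots> \<le> \<nu> B"
    using mnc_sum_le[of K B] assms by (simp add: mnc_compact compact_imp_bounded)
  finally show ?thesis .
qed

text \<open>Unions do not occur in the axioms, so the new point is reached by a sum: for
  \<open>a\<close> in \<open>A\<close>, the enlarged set lies in the sum of
  \<open>{0, x - a}\<close> and \<open>A\<close>, and the finite summand has measure 0.\<close>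

lemma mnc_insert_le:
  assumes "bounded A" shows "\<nu> (insert x A) \<le> \<nu> A"
proof (cases "A = {}")
  case True
  then show ?thesis using mnc_compact[of "{x}"] mnc_compact[of "{}"] by simp
next
  case False
  then obtain a where a: "a \<in> A" by blast
  show ?thesis
  proof (rule mnc_compact_add_le)
    show "insert x A \<subseteq> {u + b | u b. u \<in> {0, x - a} \<and> b \<in> A}"
      using a by force
  qed (use assms in auto)
qed

text \<open>The common source of compactness for the sequences below. A compact summand, the point 0
  and convex hulls do not raise the measure, so \<open>\<nu> A \<le> q * \<nu> A\<close> and
  therefore \<open>\<nu> A = 0\<close>. The point 0 in the hull allows elements of \<open>B\<close>
  to be shrunk by factors in \<open>{0..1}\<close>.\<close>

lemma compact_closure_if_mnc_contracted:
  assumes A: "bounded A" and K: "compact K" and B: "bounded B"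
    and sub: "A \<subseteq> {a + b | a b. a \<in> K \<and> b \<in> convex hull (insert 0 B)}"
    and le: "\<nu> B \<le> q * \<nu> A" and q: "q < 1"
  shows "compact (closure A)"
proof -
  have "\<nu> A \<le> \<nu> (convex hull (insert 0 B))"
    by (rule mnc_compact_add_le[OF K _ sub]) (simp add: B bounded_convex_hull)
  also have "\<dots> \<le> \<nu> (insert 0 B)"
    using B by (intro mnc_convex_hull_le) auto
  also have "\<dots> \<le> q * \<nu> A"
    using mnc_insert_le[OF B] le by (rule order_trans)
  finally have "(1 - q) * \<nu> A \<le> 0" by (simp add: algebra_simps)
  then have "\<nu> A \<le> 0" using q by (simp add: mult_le_0_iff)
  then show ?thesis using mnc_nonneg[OF A] mnc_eq_0_iff[OF A] by simp
qed

section \<open>Fixed points and unit eigenvectors of set contractions\<close>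

theorem darbo_fixed_point:
  assumes K: "closed K" "convex K" "bounded K" "K \<noteq> {}"
    and contG: "continuous_on K G" and GK: "G \<in> K \<rightarrow> K"
    and q: "q < 1" "\<And>A. A \<subseteq> K \<Longrightarrow> \<nu> (G ` A) \<le> q * \<nu> A"
  obtains x where "x \<in> K" "G x = x"
proof -
  obtain x0 where x0: "x0 \<in> K" using K by blast
  \<comment> \<open>The least invariant closed convex set through a point is the closed convex hull of its
    image and that point, hence compact.\<close>
  define S where "S = \<Inter>{D. closed D \<and> convex D \<and> x0 \<in> D \<and> D \<subseteq> K \<and> G ` D \<subseteq> D}"
  have SK: "S \<subseteq> K" using K GK x0 by (auto simp: S_def)
  have S: "closed S" "convex S" "x0 \<in> S" "G ` S \<subseteq> S"
    unfolding S_def by (auto intro!: closed_Inter convex_Inter)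
  define R where "R = closure (convex hull (insert x0 (G ` S)))"
  have RS: "R \<subseteq> S" unfolding R_def
    using S by (intro closure_minimal hull_minimal) auto
  have "insert x0 (G ` S) \<subseteq> R"
    unfolding R_def by (meson closure_subset hull_subset order_trans)
  moreover from this have "G ` R \<subseteq> R" using RS by blast
  moreover have "closed R" "convex R"
    by (simp_all add: R_def convex_closure)
  ultimately have "S \<subseteq> R"
    unfolding S_def using RS SK by (intro Inter_lower) simp
  with RS have SR: "S = R" by blast
  have bS: "bounded S" and bG: "bounded (G ` S)"
    using K(3) SK S(4) by (auto intro: bounded_subset)
  \<comment> \<open>Invariance of \<open>\<nu>\<close> under closed convex hulls meets the
    contraction property here; \<open>S\<close> is compact and Schauder's theorem applies to
    it.\<close>
  have "\<nu> S = \<nu> (insert x0 (G ` S))"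
    using bG by (subst SR) (simp add: R_def mnc_closed_convex_hull)
  also have "\<dots> \<le> q * \<nu> S"
    using mnc_insert_le[OF bG] q(2)[OF SK] by (rule order_trans)
  finally have "(1 - q) * \<nu> S \<le> 0" by (simp add: algebra_simps)
  then have "\<nu> S = 0" using q mnc_nonneg[OF bS] by (simp add: mult_le_0_iff)
  then have "compact S" using mnc_eq_0_iff[OF bS] S(1) by simp
  then obtain x where "x \<in> S" "G x = x"
    using S by (elim schauder_fixed_point[of S G]) (auto intro: continuous_on_subset[OF contG SK])
  then show thesis using that SK by blast
qed

text \<open>The radial retraction divides \<open>g y\<close> by \<open>N y \<ge> 1\<close>, which
  keeps \<open>G\<close> A\<open>inside the hull of 0 and\<close>g \<open>A\<close>. Hence
  \<open>G\<close> inherits the constant \<open>q\<close>, and Darbo's theorem applies on the unit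
  ball of the cone.\<close>

lemma schaefer_alternative:
  assumes C: "cone C" "closed C" "convex C" "C \<noteq> {}"
    and contF: "continuous_on C F" and FC: "F \<in> C \<rightarrow> C"
    and bF: "\<And>x. x \<in> C \<Longrightarrow> norm (F x) \<le> M * norm x"
    and q: "q < 1" "\<And>A. bounded A \<Longrightarrow> A \<subseteq> C \<Longrightarrow> \<nu> (F ` A) \<le> q * \<nu> A"
    and e: "e \<in> C"
  obtains (fixed) y where "y \<in> C" "F y + e = y"
    | (eigen) y s where "y \<in> C" "norm y = 1" "s \<ge> 1" "F y + e = s *\<^sub>R y"
proof -
  define g where "g y = F y + e" for y
  have gC: "g y \<in> C" if "y \<in> C" for y
    using that C(1,3) FC e unfolding g_def by (meson PiE convex_cone)
  define N where "N y = max 1 (norm (g y))" for y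
  have N1: "1 \<le> N y" for y by (simp add: N_def)
  define G where "G y = (1 / N y) *\<^sub>R g y" for y
  define K where "K = C \<inter> cball 0 1"
  have "0 \<in> C" using C by (simp add: cone_contains_0)
  have contg: "continuous_on K g"
    unfolding g_def K_def by (intro continuous_intros continuous_on_subset[OF contF]) auto
  obtain y where y: "y \<in> K" "G y = y"
  proof (rule darbo_fixed_point[of K G q])
    show "closed K" "convex K" "bounded K" "K \<noteq> {}"
      using C \<open>0 \<in> C\<close> by (auto simp: K_def intro: closed_Int convex_Int)
    show "continuous_on K G"
      unfolding G_def N_def by (intro continuous_intros contg) (auto simp: max_def)
    show "G \<in> K \<rightarrow> K"
    proof
      fix y assume "y \<in> K"
      then have "G y \<in> C" using gC N1[of y] C(1) by (auto simp: K_def G_def cone_def)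
      moreover have "norm (G y) \<le> 1" by (simp add: G_def N_def)
      ultimately show "G y \<in> K" by (simp add: K_def)
    qed
    show "\<nu> (G ` A) \<le> q * \<nu> A" if A: "A \<subseteq> K" for A
    proof -
      have bA: "bounded A" and AC: "A \<subseteq> C" using A by (auto simp: K_def intro: bounded_subset)
      have bFA: "bounded (F ` A)"
      proof (rule boundedI)
        fix z assume "z \<in> F ` A"
        then obtain a where a: "a \<in> A" "z = F a" by blast
        have "norm (F a) \<le> M * norm a" using a AC bF by blast
        \<comment> \<open>No sign of \<open>M\<close> is assumed, hence the absolute value.\<close>
        also have "\<dots> \<le> \<bar>M\<bar> * 1" using a A by (intro mult_mono) (auto simp: K_def)
        finally show "norm z \<le> \<bar>M\<bar> * 1" using a by simp
      qed
      have bg: "bounded (g ` A)"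
        using bounded_set_sum[OF bFA, of "{e}"]
        by (rule bounded_subset) (auto simp: g_def)
      have "G ` A \<subseteq> convex hull (insert 0 (g ` A))"
      proof
        fix z assume "z \<in> G ` A"
        then obtain a where a: "a \<in> A" "z = (1 / N a) *\<^sub>R g a" by (auto simp: G_def)
        have "(1 - 1 / N a) *\<^sub>R 0 + (1 / N a) *\<^sub>R g a \<in> convex hull (insert 0 (g ` A))"
          using N1[of a] a(1)
          by (intro convexD[OF convex_convex_hull] hull_inc) auto
        then show "z \<in> convex hull (insert 0 (g ` A))" using a by simp
      qed
      then have "\<nu> (G ` A) \<le> \<nu> (convex hull (insert 0 (g ` A)))"
        using bg by (intro mnc_mono bounded_convex_hull) auto
      also have "\<dots> \<le> \<nu> (insert 0 (g ` A))" using bg by (intro mnc_convex_hull_le) auto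
      also have "\<dots> \<le> \<nu> (g ` A)" using bg by (rule mnc_insert_le)
      also have "\<dots> \<le> \<nu> (F ` A)"
        by (rule mnc_compact_add_le[of "{e}"]) (use bFA in \<open>auto simp: g_def add.commute\<close>)
      also have "\<dots> \<le> q * \<nu> A" using q(2) bA AC by blast
      finally show ?thesis .
    qed
  qed (use q in auto)
  have yC: "y \<in> C" using y by (simp add: K_def)
  have gy: "F y + e = N y *\<^sub>R y"
    using arg_cong[OF y(2), of "\<lambda>v. N y *\<^sub>R v"] N1[of y] by (simp add: G_def g_def)
  \<comment> \<open>If the retraction is inactive at \<open>y\<close>, then \<open>N y = 1\<close>
    and \<open>y\<close> is a fixed point of \<open>g\<close>. Otherwise \<open>y = G y\<close> has
    norm 1 and the eigenvalue is \<open>N y\<close>.\<close>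
  show thesis
  proof (cases "norm (g y) \<le> 1")
    case True
    then show thesis using fixed[OF yC] gy by (simp add: N_def)
  next
    case False
    then have "norm (G y) = 1" by (auto simp: G_def N_def)
    then show thesis using eigen[OF yC _ N1 gy] y(2) by simp
  qed
qed

section \<open>Unbounded orbits have no upper bound\<close>

text \<open>Dividing the orbit by the running maximum of its norms gives a relatively compact
  sequence \<open>w\<close>. At record indices \<open>w\<close> has norm 1, while the scaled
  majorant \<open>y / b k\<close> tends to 0. A limit \<open>l\<close> of such terms thus has norm 1
  with both \<open>l\<close> and \<open>- l\<close> in \<open>C\<close>, against
  pointedness.\<close>

lemma no_orbit_majorant_if_unbounded:
  assumes C: "closed C" "C \<inter> uminus ` C = {0}"
    and hom: "homogeneous_on C F" and FC: "F \<in> C \<rightarrow> C"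
    and bF: "\<And>x. x \<in> C \<Longrightarrow> norm (F x) \<le> M * norm x"
    and cone: "cone C"
    and q: "q < 1" "\<And>A. bounded A \<Longrightarrow> A \<subseteq> C \<Longrightarrow> \<nu> (F ` A) \<le> q * \<nu> A"
    and u: "u \<in> C" "\<not> bounded (range (\<lambda>k. (F ^^ k) u))"
    and y: "\<And>k. y - (F ^^ k) u \<in> C"
  shows False
proof -
  define v where "v k = (F ^^ k) u" for k
  have vC: "v k \<in> C" for k
    unfolding v_def by (induction k) (use u FC in auto)
  \<comment> \<open>Needed so that the running maximum is a positive divisor from index 0
    on.\<close>
  have "u \<noteq> 0"
  proof
    assume "u = 0"
    have "norm (v k) = 0" for k
    proof (induction k)
      case (Suc k)
      have "norm (F (v k)) \<le> M * norm (v k)" using bF vC by blast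
      then show ?case using Suc by (simp add: v_def)
    qed (simp add: v_def \<open>u = 0\<close>)
    then have "range (\<lambda>k. (F ^^ k) u) \<subseteq> {0}" by (auto simp: v_def)
    from bounded_subset[OF _ this] show False using u(2) by simp
  qed
  define b where "b k = Max ((\<lambda>j. norm (v j)) ` {..k})" for k
  have b_ge: "norm (v j) \<le> b k" if "j \<le> k" for j k
    unfolding b_def using that by (intro Max_ge) auto
  have b_pos: "0 < b k" for k
  proof -
    have "0 < norm u" using \<open>u \<noteq> 0\<close> by simp
    also have "norm u \<le> b k" using b_ge[of 0 k] by (simp add: v_def)
    finally show ?thesis .
  qed
  have b_mono: "b k \<le> b (Suc k)" for k
    unfolding b_def by (intro Max_mono image_mono) auto
  define w where "w k = (1 / b k) *\<^sub>R v k" for k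
  have wC: "w k \<in> C" for k
    using vC cone b_pos[of k] by (simp add: w_def cone_def)
  have w1: "norm (w k) \<le> 1" for k
    using b_pos[of k] b_ge[of k k] by (simp add: w_def)
  have bW: "bounded (range w)" using w1 by (auto intro!: boundedI)
  have WC: "range w \<subseteq> C" using wC by auto
  have "compact (closure (range w))"
  proof (rule compact_closure_if_mnc_contracted[of _ "{0, w 0}" "F ` range w"])
    show "bounded (F ` range w)"
    proof (rule boundedI)
      fix z assume "z \<in> F ` range w"
      then obtain k where k: "z = F (w k)" by blast
      have "norm (F (w k)) \<le> M * norm (w k)" using wC bF by blast
      also have "\<dots> \<le> \<bar>M\<bar> * 1" using w1 by (intro mult_mono) auto
      finally show "norm z \<le> \<bar>M\<bar> * 1" using k by simp
    qed
    show "range w \<subseteq> {a + b | a b. a \<in> {0, w 0} \<and> b \<in> convex hull (insert 0 (F ` range w))}"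
    proof
      fix z assume "z \<in> range w"
      then obtain k where k: "z = w k" by blast
      have 0: "0 \<in> convex hull (insert 0 (F ` range w))" by (rule hull_inc) simp
      show "z \<in> {a + b | a b. a \<in> {0, w 0} \<and> b \<in> convex hull (insert 0 (F ` range w))}"
      proof (cases k)
        case 0
        with k \<open>0 \<in> convex hull (insert 0 (F ` range w))\<close> show ?thesis by force
      next
        case (Suc i)
        have F: "F (w i) = (1 / b i) *\<^sub>R v (Suc i)"
          using hom vC[of i] b_pos[of i] by (simp add: homogeneous_on_def w_def v_def)
        \<comment> \<open>Running maxima increase, so \<open>w k\<close> is \<open>F (w i)\<close>
          shrunk by the factor \<open>b i / b k\<close>, which puts it in the hull with 0. Only
          \<open>w 0\<close> has no predecessor and goes to the compact summand.\<close>
        have "w k = (1 - b i / b k) *\<^sub>R 0 + (b i / b k) *\<^sub>R F (w i)"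
          unfolding F using Suc b_pos[of i] by (simp add: w_def)
        also have "\<dots> \<in> convex hull (insert 0 (F ` range w))"
          using b_pos[of i] b_pos[of k] b_mono[of i] Suc
          by (intro convexD[OF convex_convex_hull] hull_inc) auto
        finally show ?thesis using k by force
      qed
    qed
  qed (use q bW WC in auto)
  have rec: "\<exists>k. norm (w k) = 1 \<and> real n + 1 \<le> b k" for n
  proof -
    \<comment> \<open>The first index at which the norm reaches \<open>real n + 1\<close> is a
      record, so there the running maximum equals the current norm.\<close>
    have "\<exists>k. real n + 1 \<le> norm (v k)"
      using u(2) unfolding v_def by (force simp: bounded_iff not_le intro: less_imp_le)
    then obtain k where k: "real n + 1 \<le> norm (v k)" "\<And>j. j < k \<Longrightarrow> norm (v j) < real n + 1"
      using exists_least_iff[of "\<lambda>k. real n + 1 \<le> norm (v k)"] by (auto simp: not_le)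
    have "norm (v j) \<le> norm (v k)" if "j \<le> k" for j
      using k(1) k(2)[of j] that by (cases "j = k") auto
    then have "b k \<le> norm (v k)" unfolding b_def by (intro Max.boundedI) auto
    then have "b k = norm (v k)" using b_ge[of k k] by simp
    then show ?thesis using k(1) b_pos[of k] by (intro exI[of _ k]) (simp add: w_def)
  qed
  then obtain \<kappa> where \<kappa>: "\<And>n. norm (w (\<kappa> n)) = 1" "\<And>n. real n + 1 \<le> b (\<kappa> n)" by metis
  have "w (\<kappa> n) \<in> closure (range w)" for n by (meson closure_subset rangeI subsetD)
  then obtain l \<sigma> where l: "strict_mono \<sigma>" "((\<lambda>n. w (\<kappa> n)) \<circ> \<sigma>) \<longlonglongrightarrow> l"
    using \<open>compact (closure (range w))\<close> unfolding compact_eq_seq_compact_metric seq_compact_def by metis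
  have wl: "(\<lambda>n. w (\<kappa> (\<sigma> n))) \<longlonglongrightarrow> l" using l by (simp add: o_def)
  have "norm l = 1"
    using tendsto_norm[OF wl] \<kappa> by (simp add: LIMSEQ_const_iff)
  have "l \<in> C" by (rule closed_sequentially[OF C(1) _ wl]) (use wC in auto)
  have "(\<lambda>n. inverse (real (Suc n)) * norm y) \<longlonglongrightarrow> 0 * norm y"
    by (intro tendsto_mult LIMSEQ_inverse_real_of_nat tendsto_const)
  then have "(\<lambda>n. inverse (real (Suc n)) * norm y) \<longlonglongrightarrow> 0" by simp
  then have "(\<lambda>n. (1 / b (\<kappa> n)) *\<^sub>R y) \<longlonglongrightarrow> 0"
  proof (rule Lim_null_comparison[rotated], intro always_eventually allI)
    fix n
    have le: "1 / b (\<kappa> n) \<le> inverse (real (Suc n))"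
      using \<kappa>(2)[of n] by (simp add: divide_simps)
    show "norm ((1 / b (\<kappa> n)) *\<^sub>R y) \<le> inverse (real (Suc n)) * norm y"
      using mult_right_mono[OF le norm_ge_zero[of y]] b_pos[of "\<kappa> n"] by simp
  qed
  from LIMSEQ_subseq_LIMSEQ[OF this l(1)]
  have "(\<lambda>n. (1 / b (\<kappa> (\<sigma> n))) *\<^sub>R y - w (\<kappa> (\<sigma> n))) \<longlonglongrightarrow> 0 - l"
    by (intro tendsto_diff wl) (simp add: o_def)
  moreover have "(1 / b k) *\<^sub>R y - w k \<in> C" for k
    using y[of k] cone b_pos[of k] by (simp add: w_def v_def cone_def flip: scaleR_diff_right)
  ultimately have "- l \<in> C"
    using closed_sequentially[OF C(1), of "\<lambda>n. (1 / b (\<kappa> (\<sigma> n))) *\<^sub>R y - w (\<kappa> (\<sigma> n))"] by simp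
  then have "l \<in> C \<inter> uminus ` C" using \<open>l \<in> C\<close> image_eqI[of l uminus "- l"] by simp
  then show False using C(2) \<open>norm l = 1\<close> by auto
qed

end

subsection \<open>Maps on cones\<close>

lemma cone_add: "cone C \<Longrightarrow> convex C \<Longrightarrow> x \<in> C \<Longrightarrow> y \<in> C \<Longrightarrow> x + y \<in> (C :: 'a::real_vector set)"
  by (meson convex_cone)

lemma cone_le_trans: "cone C \<Longrightarrow> convex C \<Longrightarrow> cone_le C x y \<Longrightarrow> cone_le C y z \<Longrightarrow> cone_le C x z"
  unfolding cone_le_def using cone_add[of C "y - x" "z - y"] by simp

lemma cone_le_scaleR: "cone C \<Longrightarrow> 0 \<le> c \<Longrightarrow> cone_le C x y \<Longrightarrow> cone_le C (c *\<^sub>R x) (c *\<^sub>R y)"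
  unfolding cone_le_def using mem_cone[of C "y - x" c] by (simp add: scaleR_diff_right)

text \<open>Continuity at 0 bounds \<open>h\<close> on a small ball of the cone, and homogeneity
  carries the bound to every vector.\<close>

lemma homogeneous_bound:
  fixes C :: "'a::real_normed_vector set"
  assumes "cone C" "0 \<in> C" and h: "continuous_on C h" "homogeneous_on C h"
  obtains M where "0 < M" "\<And>x. x \<in> C \<Longrightarrow> norm (h x) \<le> M * norm x"
proof -
  have hom: "\<And>x t. x \<in> C \<Longrightarrow> 0 < t \<Longrightarrow> h (t *\<^sub>R x) = t *\<^sub>R h x"
    using h(2) by (auto simp: homogeneous_on_def)
  \<comment> \<open>Homogeneity covers positive factors only; the value at 0 comes from
    \<open>h 0 = 2 h 0\<close>.\<close>
  have h0: "h 0 = 0"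
    using hom[OF assms(2), of 2] by (simp add: scaleR_2)
  obtain d where d: "0 < d" "\<And>x. x \<in> C \<Longrightarrow> norm x \<le> d \<Longrightarrow> norm (h x) \<le> 1"
  proof -
    obtain d where "0 < d" "\<And>x. x \<in> C \<Longrightarrow> dist x 0 < d \<Longrightarrow> dist (h x) (h 0) < 1"
      using h(1) assms(2) unfolding continuous_on_iff by (metis zero_less_one)
    \<comment> \<open>Halving the radius makes the closed ball admissible, since the rescaled vector
      below has norm exactly \<open>d\<close>.\<close>
    then show thesis by (intro that[of "d / 2"]) (force simp: h0 intro: less_imp_le)+
  qed
  have "norm (h x) \<le> (1 / d) * norm x" if x: "x \<in> C" for x
  proof (cases "x = 0")
    case False
    define t where "t = d / norm x"
    have t: "0 < t" using d False by (simp add: t_def)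
    have "norm (h (t *\<^sub>R x)) \<le> 1"
      using d False x t assms(1) by (intro d(2) mem_cone) (auto simp: t_def)
    then have "t * norm (h x) \<le> 1" using hom[OF x t] t by simp
    then show ?thesis using False d by (simp add: t_def field_simps)
  qed (simp add: h0)
  then show thesis using that[of "1 / d"] d(1) by simp
qed

lemma funpow_in: "h \<in> C \<rightarrow> C \<Longrightarrow> x \<in> C \<Longrightarrow> (h ^^ k) x \<in> C"
  by (induction k) auto

lemma continuous_on_funpow:
  assumes "h \<in> C \<rightarrow> C" "continuous_on C h" shows "continuous_on C (h ^^ k)"
proof (induction k)
  case (Suc k)
  show ?case
    using continuous_on_compose2[OF assms(2) Suc] funpow_in[OF assms(1)] by (auto simp: o_def)
qed simp

lemma homogeneous_on_funpow:
  assumes "h \<in> C \<rightarrow> C" "homogeneous_on C h" shows "homogeneous_on C (h ^^ k)"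
proof (induction k)
  case (Suc k)
  then show ?case
    using assms(2) funpow_in[OF assms(1)] by (simp add: homogeneous_on_def)
qed (simp add: homogeneous_on_def)

lemma cone_order_preserving_funpow:
  assumes "h \<in> C \<rightarrow> C" "cone_order_preserving C h" shows "cone_order_preserving C (h ^^ k)"
proof (induction k)
  case (Suc k)
  then show ?case
    using assms(2) funpow_in[OF assms(1)] by (simp add: cone_order_preserving_def)
qed (simp add: cone_order_preserving_def)

lemma scaled_map:
  assumes "cone C" "0 < c" "f \<in> C \<rightarrow> C"
  shows "(\<lambda>x. c *\<^sub>R f x) \<in> C \<rightarrow> C"
    and "homogeneous_on C f \<Longrightarrow> homogeneous_on C (\<lambda>x. c *\<^sub>R f x)"
    and "cone_order_preserving C f \<Longrightarrow> cone_order_preserving C (\<lambda>x. c *\<^sub>R f x)"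
proof -
  show "(\<lambda>x. c *\<^sub>R f x) \<in> C \<rightarrow> C"
    using assms by (auto intro!: mem_cone)
qed (use assms in \<open>auto simp: homogeneous_on_def cone_order_preserving_def cone_le_scaleR\<close>)

lemma funpow_scaled_map:
  assumes "f \<in> C \<rightarrow> C" "homogeneous_on C f" "0 < c" "u \<in> C"
  shows "((\<lambda>x. c *\<^sub>R f x) ^^ k) u = c ^ k *\<^sub>R (f ^^ k) u"
proof (induction k)
  case (Suc k)
  have "f (c ^ k *\<^sub>R (f ^^ k) u) = c ^ k *\<^sub>R f ((f ^^ k) u)"
    using assms funpow_in[OF assms(1,4), of k] by (simp add: homogeneous_on_def)
  then show ?case using Suc by simp
qed simp

lemma funpow_norm_le:
  assumes "h \<in> C \<rightarrow> C" "0 \<le> M" "\<And>x. x \<in> C \<Longrightarrow> norm (h x) \<le> M * norm x" "x \<in> C"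
  shows "norm ((h ^^ k) x) \<le> M ^ k * norm x"
proof (induction k)
  case (Suc k)
  have "norm (h ((h ^^ k) x)) \<le> M * norm ((h ^^ k) x)"
    using assms(3) funpow_in[OF assms(1,4)] by blast
  also have "\<dots> \<le> M * (M ^ k * norm x)" using Suc assms(2) by (rule mult_left_mono)
  finally show ?case by (simp add: mult.assoc)
qed simp

section \<open>Consequences of the two spectral radii for iterates\<close>

text \<open>If the orbit under \<open>h ^^ m\<close>, scaled by \<open>l ^ m\<close>, were bounded,
  the at most \<open>m - 1\<close> remaining applications of \<open>h\<close> would cost only a
  constant factor, and the whole orbit would grow at most like \<open>D * l ^ N\<close>. This
  contradicts a growth rate above \<open>a > l\<close>.\<close>

lemma unbounded_scaled_orbit:
  fixes C :: "'a::real_normed_vector set"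
  assumes C: "cone C" "0 \<in> C" and h: "h \<in> C \<rightarrow> C" "continuous_on C h" "homogeneous_on C h"
    and l: "0 < l" "ennreal l < cone_spectral_radius C h" and m: "0 < m"
  obtains u where "u \<in> C" "\<not> bounded (range (\<lambda>k. (1 / l ^ m) ^ k *\<^sub>R ((h ^^ m) ^^ k) u))"
proof -
  obtain e where e: "ennreal l < e" "e < cone_spectral_radius C h"
    using dense[OF l(2)] by blast
  then have e_top: "e < top" using top.not_eq_extremum by fastforce
  define a where "a = enn2real e"
  have ea: "e = ennreal a" using e_top by (simp add: a_def)
  have a: "l < a" using e(1) l(1) by (simp add: ea ennreal_less_iff)
  obtain u where u: "u \<in> C" "ennreal a < limsup (\<lambda>k. ennreal (root k (norm ((h ^^ k) u))))"
    using e(2) unfolding cone_spectral_radius_def less_SUP_iff ea by blast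
  obtain M0 where M0: "0 < M0" "\<And>x. x \<in> C \<Longrightarrow> norm (h x) \<le> M0 * norm x"
    using homogeneous_bound[OF C h(2,3)] by blast
  \<comment> \<open>The maximum with \<open>l\<close> gives \<open>M / l \<ge> 1\<close>, so that
    \<open>(M / l) ^ j\<close> is at most \<open>(M / l) ^ m\<close> for each remainder
    \<open>j\<close>.\<close>
  define M where "M = max M0 l"
  have M: "l \<le> M" "0 < M" using M0 by (auto simp: M_def)
  have hM: "norm (h x) \<le> M * norm x" if "x \<in> C" for x
    using M0(2)[OF that] mult_right_mono[of M0 M "norm x"] by (simp add: M_def)
  have "\<not> bounded (range (\<lambda>k. (1 / l ^ m) ^ k *\<^sub>R ((h ^^ m) ^^ k) u))"
  proof
    assume "bounded (range (\<lambda>k. (1 / l ^ m) ^ k *\<^sub>R ((h ^^ m) ^^ k) u))"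
    then obtain B where B: "\<And>k. norm ((1 / l ^ m) ^ k *\<^sub>R ((h ^^ m) ^^ k) u) \<le> B"
      by (auto simp: bounded_iff)
    have B': "norm ((h ^^ (m * k)) u) \<le> B * l ^ (m * k)" for k
      using B[of k] l(1) by (simp add: funpow_mult power_mult power_one_over divide_simps)
    have "0 \<le> B" using B[of 0] norm_ge_zero order_trans by blast
    define D where "D = B * (M / l) ^ m"
    have bound: "norm ((h ^^ N) u) \<le> D * l ^ N" for N
    proof -
      define k j where "k = N div m" and "j = N mod m"
      have N: "N = j + m * k" and j: "j \<le> m" using m by (auto simp: k_def j_def less_imp_le)
      have "norm ((h ^^ N) u) \<le> M ^ j * norm ((h ^^ (m * k)) u)"
        unfolding N funpow_add comp_apply
        using M by (intro funpow_norm_le[OF h(1) _ hM] funpow_in h u) auto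
      also have "\<dots> \<le> M ^ j * (B * l ^ (m * k))"
        using B' M by (intro mult_left_mono) auto
      also have "\<dots> = B * (M / l) ^ j * l ^ N"
        using l by (simp add: N power_add power_divide)
      also have "\<dots> \<le> D * l ^ N"
        unfolding D_def using \<open>0 \<le> B\<close> M l j by (intro mult_right_mono mult_left_mono power_increasing) auto
      finally show ?thesis .
    qed
    have "LIM N sequentially. norm ((a / l) ^ N) :> at_top"
      using a l
      by (intro filterlim_at_infinity_imp_norm_at_top filterlim_realpow_sequentially_gt1) auto
    then have "LIM N sequentially. (a / l) ^ N :> at_top"
      using a l by simp
    \<comment> \<open>The gap between \<open>l\<close> and \<open>a\<close> absorbs the constant
      \<open>D\<close>.\<close>
    then have "\<forall>\<^sub>F N in sequentially. D \<le> (a / l) ^ N"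
      by (simp add: filterlim_at_top)
    then have "\<forall>\<^sub>F N in sequentially. ennreal (root N (norm ((h ^^ N) u))) \<le> ennreal a"
      using eventually_gt_at_top[of 0]
    proof eventually_elim
      case (elim N)
      have "norm ((h ^^ N) u) \<le> (a / l) ^ N * l ^ N"
        using bound[of N] elim l by (smt (verit) mult_right_mono zero_le_power)
      also have "\<dots> = a ^ N" using l by (simp add: power_divide)
      finally have "root N (norm ((h ^^ N) u)) \<le> root N (a ^ N)" using elim by simp
      also have "\<dots> = a" using a l elim by (simp add: real_root_power_cancel)
      finally show ?case by (rule ennreal_leI)
    qed
    then have "limsup (\<lambda>k. ennreal (root k (norm ((h ^^ k) u)))) \<le> ennreal a"
      by (rule Limsup_bounded)
    with u(2) show False by simp
  qed
  with u(1) show thesis using that by blast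
qed

text \<open>A strict bound on an infimum is met by a member. This is used twice: for the exponent
  \<open>m\<close>, then for an admissible constant of \<open>h ^^ m\<close>.\<close>

lemma exists_contractive_iterate:
  assumes "cone_essential_spectral_radius \<nu> C h < ennreal r" "0 \<le> r"
  obtains m \<mu> where "0 < m" "0 < \<mu>" "\<mu> < r ^ m"
    "\<And>A. bounded A \<Longrightarrow> A \<subseteq> C \<Longrightarrow> \<nu> ((h ^^ m) ` A) \<le> \<mu> * \<nu> A"
proof -
  obtain m where m: "0 < m" "ennreal_root m (mnc_constant \<nu> C (h ^^ m)) < ennreal r"
    using assms(1) unfolding cone_essential_spectral_radius_def INF_less_iff by (auto simp: Suc_le_eq)
  define c where "c = enn2real (mnc_constant \<nu> C (h ^^ m))"
  \<comment> \<open>\<open>ennreal_root\<close> sends \<open>top\<close> to \<open>top\<close>, so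
    an infinite constant would violate the strict bound.\<close>
  have "mnc_constant \<nu> C (h ^^ m) \<noteq> top"
    using m(2) by (auto simp: ennreal_root_def)
  then have c: "mnc_constant \<nu> C (h ^^ m) = ennreal c"
    by (simp add: c_def top.not_eq_extremum)
  have "0 \<le> c" by (simp add: c_def)
  have "root m c < r"
    using m \<open>mnc_constant \<nu> C (h ^^ m) \<noteq> top\<close> \<open>0 \<le> c\<close>
    by (simp add: ennreal_root_def ennreal_less_iff flip: c_def)
  then have "root m c ^ m < r ^ m"
    using m \<open>0 \<le> c\<close> by (intro power_strict_mono) auto
  then have "c < r ^ m" using m \<open>0 \<le> c\<close> by simp
  then have "mnc_constant \<nu> C (h ^^ m) < ennreal (r ^ m)"
    using c \<open>0 \<le> c\<close> by (simp add: ennreal_less_iff)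
  then obtain \<mu> where "0 < \<mu>" "ennreal \<mu> < ennreal (r ^ m)"
    "\<And>A. bounded A \<Longrightarrow> A \<subseteq> C \<Longrightarrow> \<nu> ((h ^^ m) ` A) \<le> \<mu> * \<nu> A"
    unfolding mnc_constant_def Inf_less_iff by blast
  then show thesis using that[OF m(1), of \<mu>] by (simp add: ennreal_less_iff)
qed

lemma compact_insert_range_limit:
  fixes x :: "nat \<Rightarrow> 'a::metric_space"
  assumes "x \<longlonglongrightarrow> l"
  shows "compact (insert l (range x))"
  using compactin_sequence_with_limit[of euclidean x l "range x"] assms by simp

section \<open>A unit vector dominated by its scaled image under the iterate\<close>

text \<open>Applied with \<open>f = h ^^ m\<close> and \<open>R = r ^ m\<close>. For
  \<open>L\<close> between \<open>\<mu>\<close> and \<open>R\<close>, the unbounded orbit of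
  \<open>u\<close> rules out the fixed point branch of the alternative for \<open>f / L\<close>
  perturbed by a multiple of \<open>u\<close>. What remains is a unit vector \<open>y\<close> with
  \<open>f y + e = s y\<close>, where \<open>s \<ge> L\<close> and \<open>e\<close> is small; such
  vectors cluster as \<open>L\<close> tends to \<open>R\<close>.\<close>

lemma exists_superharmonic:
  fixes C :: "'a::real_normed_vector set"
  assumes \<nu>: "homogeneous_generalized_mnc \<nu>" and C: "proper_cone C"
    and f: "f \<in> C \<rightarrow> C" "continuous_on C f" "homogeneous_on C f" "cone_order_preserving C f"
    and \<mu>: "0 < \<mu>" "\<mu> < R" "\<And>A. bounded A \<Longrightarrow> A \<subseteq> C \<Longrightarrow> \<nu> (f ` A) \<le> \<mu> * \<nu> A"
    and unb: "\<And>L. 0 < L \<Longrightarrow> L < R \<Longrightarrow> \<exists>u\<in>C. \<not> bounded (range (\<lambda>k. (1 / L) ^ k *\<^sub>R (f ^^ k) u))"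
  obtains x where "x \<in> C" "norm x = 1" "f x - R *\<^sub>R x \<in> C"
proof -
  have cC: "cone C" "closed C" "convex C" and pt: "C \<inter> uminus ` C = {0}"
    using C by (auto simp: proper_cone_def)
  have C0: "0 \<in> C" using pt by auto
  obtain M where M: "0 < M" "\<And>x. x \<in> C \<Longrightarrow> norm (f x) \<le> M * norm x"
    using homogeneous_bound[OF cC(1) C0 f(2,3)] by blast
  have fA: "bounded (f ` A)" if "bounded A" "A \<subseteq> C" for A
  proof -
    obtain b where "\<And>x. x \<in> A \<Longrightarrow> norm x \<le> b" using \<open>bounded A\<close> by (auto simp: bounded_iff)
    then have "norm (f x) \<le> M * b" if "x \<in> A" for x
      using M \<open>A \<subseteq> C\<close> that by (meson mult_left_mono less_imp_le order_trans subsetD)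
    then show ?thesis by (auto simp: bounded_iff)
  qed
  have approx: "\<exists>y s e. y \<in> C \<and> norm y = 1 \<and> L \<le> s \<and> e \<in> C \<and> norm e \<le> \<epsilon> \<and> f y + e = s *\<^sub>R y"
    if L: "\<mu> < L" "L < R" and \<epsilon>: "0 < \<epsilon>" for L \<epsilon>
  proof -
    have L0: "0 < L" using L \<mu> by simp
    define F where "F x = (1 / L) *\<^sub>R f x" for x
    have F: "F \<in> C \<rightarrow> C" "homogeneous_on C F" "cone_order_preserving C F"
      unfolding F_def using scaled_map[OF cC(1) _ f(1), of "1 / L"] L0 f by auto
    have contF: "continuous_on C F" unfolding F_def by (intro continuous_intros f)
    have FA: "\<nu> (F ` A) \<le> (\<mu> / L) * \<nu> A" if A: "bounded A" "A \<subseteq> C" for A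
    proof -
      have "\<nu> (F ` A) = (1 / L) * \<nu> (f ` A)"
        using mnc_scaleR[OF \<nu> fA[OF A], of "1 / L"] L0 by (simp add: F_def image_image)
      also have "\<dots> \<le> (1 / L) * (\<mu> * \<nu> A)"
        using \<mu>(3)[OF A] L0 by (intro mult_left_mono) auto
      finally show ?thesis by simp
    qed
    have MF: "norm (F x) \<le> (M / L) * norm x" if "x \<in> C" for x
      using M(2)[OF that] L0 by (simp add: F_def divide_right_mono)
    have "(F ^^ k) u = (1 / L) ^ k *\<^sub>R (f ^^ k) u" if "u \<in> C" for k u
      using funpow_scaled_map[OF f(1,3) _ that, of "1 / L"] L0 by (simp add: F_def[abs_def])
    then obtain u where u: "u \<in> C" "\<not> bounded (range (\<lambda>k. (F ^^ k) u))"
      using unb[OF L0 L(2)] by auto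
    \<comment> \<open>Chosen so that the perturbation, after multiplication by \<open>L\<close>, has
      norm at most \<open>\<epsilon>\<close>; the added 1 keeps the denominator positive.\<close>
    define t where "t = \<epsilon> / (L * (norm u + 1))"
    have nu: "0 < norm u + 1" by (simp add: add_nonneg_pos)
    have t: "0 < t" using \<epsilon> L0 nu by (simp add: t_def)
    have "\<epsilon> = L * t * (norm u + 1)" using L0 nu by (simp add: t_def)
    then have e\<epsilon>: "norm ((L * t) *\<^sub>R u) \<le> \<epsilon>" using L0 t by simp
    have tuC: "t *\<^sub>R u \<in> C" using u t cC by (simp add: mem_cone)
    show ?thesis
    proof (rule schaefer_alternative[OF \<nu> cC _ contF F(1) MF _ FA tuC])
      fix y assume y: "y \<in> C" "F y + t *\<^sub>R u = y"
      \<comment> \<open>From \<open>y = F y + t u\<close> both \<open>t u \<le> y\<close> and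
        \<open>F y \<le> y\<close> follow, and monotonicity of \<open>F\<close> propagates the first
        bound along the orbit.\<close>
      have "cone_le C (t *\<^sub>R (F ^^ k) u) y" for k
      proof (induction k)
        case 0
        have "y - t *\<^sub>R u = F y" using y(2) by (metis add_diff_cancel_right')
        then show ?case using y(1) F(1) by (auto simp: cone_le_def)
      next
        case (Suc k)
        have k: "(F ^^ k) u \<in> C" using funpow_in[OF F(1) u(1)] .
        have "cone_le C (F (t *\<^sub>R (F ^^ k) u)) (F y)"
          using F(3) Suc y(1) k t cC by (simp add: cone_order_preserving_def mem_cone)
        then have "cone_le C (t *\<^sub>R F ((F ^^ k) u)) (F y)"
          using F(2) k t by (simp add: homogeneous_on_def)
        moreover have "cone_le C (F y) y"
          using tuC y(2) by (metis add_diff_cancel_left' cone_le_def)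
        ultimately show ?case using cone_le_trans[OF cC(1,3)] by simp
      qed
      then have "cone_le C ((1 / t) *\<^sub>R (t *\<^sub>R (F ^^ k) u)) ((1 / t) *\<^sub>R y)" for k
        using t by (intro cone_le_scaleR cC) auto
      then have "(1 / t) *\<^sub>R y - (F ^^ k) u \<in> C" for k
        using t by (simp add: cone_le_def)
      then have False
        using no_orbit_majorant_if_unbounded[OF \<nu> cC(2) pt F(2,1) MF cC(1) _ FA u,
            where y = "(1 / t) *\<^sub>R y"] L L0 by simp
      then show ?thesis ..
    next
      fix y s assume y: "y \<in> C" "norm y = 1" "1 \<le> s" "F y + t *\<^sub>R u = s *\<^sub>R y"
      have "f y + (L * t) *\<^sub>R u = L *\<^sub>R (F y + t *\<^sub>R u)"
        using L0 by (simp add: F_def scaleR_add_right)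
      also have "\<dots> = (L * s) *\<^sub>R y" by (simp add: y(4))
      finally have "f y + (L * t) *\<^sub>R u = (L * s) *\<^sub>R y" .
      moreover have "(L * t) *\<^sub>R u \<in> C" using u t L0 cC by (simp add: mem_cone)
      moreover have "L \<le> L * s" using y(3) L0 by simp
      ultimately show ?thesis using y e\<epsilon> by blast
    qed (use C0 L L0 in auto)
  qed
  \<comment> \<open>\<open>L0\<close> is the midpoint of \<open>\<mu>\<close> and \<open>R\<close>.
    It bounds every \<open>s n\<close> from below, which makes the contraction factor
    \<open>\<mu> / L0\<close> independent of \<open>n\<close>.\<close>
  define \<delta> where "\<delta> = (R - \<mu>) / 2"
  define L0 where "L0 = R - \<delta>"
  have \<delta>: "0 < \<delta>" "\<mu> < L0" "L0 < R" "0 < L0" using \<mu> by (auto simp: \<delta>_def L0_def field_simps)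
  have "\<exists>y s e. y \<in> C \<and> norm y = 1 \<and> R - \<delta> * inverse (real (Suc n)) \<le> s \<and> e \<in> C \<and>
    norm e \<le> inverse (real (Suc n)) \<and> f y + e = s *\<^sub>R y" for n
  proof (rule approx)
    have "\<delta> * inverse (real (Suc n)) \<le> \<delta> * 1"
      using \<delta>(1) by (intro mult_left_mono) (auto simp: field_simps)
    then show "\<mu> < R - \<delta> * inverse (real (Suc n))" using \<delta>(2) unfolding L0_def by linarith
    show "R - \<delta> * inverse (real (Suc n)) < R" using \<delta>(1) by simp
  qed simp
  then obtain y s e where yse: "\<And>n. y n \<in> C" "\<And>n. norm (y n) = 1"
    "\<And>n. R - \<delta> * inverse (real (Suc n)) \<le> s n" "\<And>n. e n \<in> C"
    "\<And>n. norm (e n) \<le> inverse (real (Suc n))" "\<And>n. f (y n) + e n = s n *\<^sub>R y n"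
    by metis
  have sL: "L0 \<le> s n" for n
  proof -
    have "\<delta> * inverse (real (Suc n)) \<le> \<delta> * 1"
      using \<delta>(1) by (intro mult_left_mono) (auto simp: field_simps)
    then show ?thesis using yse(3)[of n] by (simp add: L0_def)
  qed
  have e0: "e \<longlonglongrightarrow> 0"
    by (rule Lim_null_comparison[OF _ LIMSEQ_inverse_real_of_nat]) (use yse(5) in auto)
  have YC: "range y \<subseteq> C" and bY: "bounded (range y)"
    using yse(1,2) by (auto simp: bounded_iff)
  have "compact (closure (range y))"
  proof (rule compact_closure_if_mnc_contracted[OF \<nu> bY])
    have "(\<lambda>n. (1 / s n) *\<^sub>R e n) \<longlonglongrightarrow> 0"
    proof (rule Lim_null_comparison[where g = "\<lambda>n. (1 / L0) * norm (e n)"])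
      show "\<forall>\<^sub>F n in sequentially. norm ((1 / s n) *\<^sub>R e n) \<le> (1 / L0) * norm (e n)"
        using sL \<delta>(4) by (intro always_eventually allI)
          (smt (verit) abs_of_pos divide_pos_pos frac_le mult_right_mono norm_ge_zero norm_scaleR)
      show "(\<lambda>n. (1 / L0) * norm (e n)) \<longlonglongrightarrow> 0"
        using tendsto_mult_left[OF tendsto_norm[OF e0], of "1 / L0"] by simp
    qed
    then show "compact (insert 0 (range (\<lambda>n. (1 / s n) *\<^sub>R e n)))"
      by (rule compact_insert_range_limit)
    show bB: "bounded ((\<lambda>x. (1 / L0) *\<^sub>R x) ` f ` range y)"
      by (intro bounded_scaling fA bY YC)
    show "range y \<subseteq> {a + b | a b. a \<in> insert 0 (range (\<lambda>n. (1 / s n) *\<^sub>R e n)) \<and>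
        b \<in> convex hull (insert 0 ((\<lambda>x. (1 / L0) *\<^sub>R x) ` f ` range y))}"
    proof
      fix z assume "z \<in> range y"
      then obtain n where n: "z = y n" by blast
      have s: "0 < s n" using sL[of n] \<delta> by simp
      \<comment> \<open>The equation for \<open>y n\<close> is split as \<open>e n / s n\<close>
        plus \<open>L0 / s n\<close> times \<open>f (y n) / L0\<close>. The first summand is a null
        sequence, hence lies in a compact set; the factor \<open>L0 / s n \<le> 1\<close> puts the
        second into the hull with 0.\<close>
      have "(1 - L0 / s n) *\<^sub>R 0 + (L0 / s n) *\<^sub>R ((1 / L0) *\<^sub>R f (y n))
          \<in> convex hull (insert 0 ((\<lambda>x. (1 / L0) *\<^sub>R x) ` f ` range y))"
        using s sL[of n] \<delta>(4)
        by (intro convexD[OF convex_convex_hull] hull_inc) auto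
      moreover have "y n = (1 / s n) *\<^sub>R e n + ((1 - L0 / s n) *\<^sub>R 0 + (L0 / s n) *\<^sub>R ((1 / L0) *\<^sub>R f (y n)))"
      proof -
        have "y n = (1 / s n) *\<^sub>R (f (y n) + e n)" using s by (simp add: yse(6))
        also have "\<dots> = (1 / s n) *\<^sub>R e n + (1 / s n) *\<^sub>R f (y n)" by (simp add: scaleR_add_right)
        finally show ?thesis using \<delta>(4) by simp
      qed
      ultimately show "z \<in> {a + b | a b. a \<in> insert 0 (range (\<lambda>n. (1 / s n) *\<^sub>R e n)) \<and>
        b \<in> convex hull (insert 0 ((\<lambda>x. (1 / L0) *\<^sub>R x) ` f ` range y))}"
        unfolding n by blast
    qed
    have "\<nu> ((\<lambda>x. (1 / L0) *\<^sub>R x) ` f ` range y) = (1 / L0) * \<nu> (f ` range y)"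
      using mnc_scaleR[OF \<nu> fA[OF bY YC], of "1 / L0"] \<delta>(4) by simp
    also have "\<dots> \<le> (1 / L0) * (\<mu> * \<nu> (range y))"
      using \<mu>(3)[OF bY YC] \<delta>(4) by (intro mult_left_mono) auto
    finally show "\<nu> ((\<lambda>x. (1 / L0) *\<^sub>R x) ` f ` range y) \<le> (\<mu> / L0) * \<nu> (range y)" by simp
    show "\<mu> / L0 < 1" using \<delta> by simp
  qed
  moreover have "\<forall>n. y n \<in> closure (range y)" by (meson closure_subset rangeI subsetD)
  ultimately obtain l \<sigma> where l: "strict_mono \<sigma>" "(y \<circ> \<sigma>) \<longlonglongrightarrow> l"
    unfolding compact_eq_seq_compact_metric seq_compact_def by metis
  have yl: "(\<lambda>n. y (\<sigma> n)) \<longlonglongrightarrow> l" using l by (simp add: o_def)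
  have lC: "l \<in> C" by (rule closed_sequentially[OF cC(2) _ yl]) (use yse in auto)
  have "norm l = 1" using tendsto_norm[OF yl] by (simp add: yse(2) LIMSEQ_const_iff)
  have inv: "(\<lambda>n. inverse (real (Suc (\<sigma> n)))) \<longlonglongrightarrow> 0"
    using LIMSEQ_subseq_LIMSEQ[OF LIMSEQ_inverse_real_of_nat l(1)] by (simp add: o_def)
  have lim: "(\<lambda>n. f (y (\<sigma> n)) + e (\<sigma> n) - (R - \<delta> * inverse (real (Suc (\<sigma> n)))) *\<^sub>R y (\<sigma> n))
      \<longlonglongrightarrow> f l + 0 - (R - \<delta> * 0) *\<^sub>R l"
    using LIMSEQ_subseq_LIMSEQ[OF e0 l(1)]
    by (intro tendsto_intros yl inv continuous_on_tendsto_compose[OF f(2) yl lC])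
      (use yse in \<open>auto simp: o_def\<close>)
  \<comment> \<open>The \<open>s n\<close> need not converge to \<open>R\<close>. Replacing
    \<open>s n\<close> by its lower bound leaves a nonnegative multiple of \<open>y n\<close>, and
    this membership in the closed set \<open>C\<close> survives the limit.\<close>
  have "f (y n) + e n - (R - \<delta> * inverse (real (Suc n))) *\<^sub>R y n \<in> C" for n
    using yse(1)[of n] yse(3)[of n] cC(1)
    by (simp only: yse(6) flip: scaleR_diff_left) (simp add: mem_cone)
  then have "f l + 0 - (R - \<delta> * 0) *\<^sub>R l \<in> C"
    by (intro closed_sequentially[OF cC(2) _ lim]) simp
  then show thesis using that[OF lC \<open>norm l = 1\<close>] by simp
qed

section \<open>From the iterate back to the map, by finite suprema\<close>

lemma sup_semilattice_finite_sup:
  fixes x :: "nat \<Rightarrow> 'a::real_vector"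
  assumes C: "cone C" "convex C" and sup: "sup_semilattice_in_cone_order C D" and x: "\<And>j. x j \<in> D"
  shows "\<exists>z\<in>D. (\<forall>j\<le>n. cone_le C (x j) z) \<and> (\<forall>w\<in>D. (\<forall>j\<le>n. cone_le C (x j) w) \<longrightarrow> cone_le C z w)"
proof (induction n)
  case 0
  have "\<exists>z\<in>D. cone_le C (x 0) z \<and> cone_le C (x 0) z \<and>
      (\<forall>w\<in>D. cone_le C (x 0) w \<and> cone_le C (x 0) w \<longrightarrow> cone_le C z w)"
    using sup x[of 0] unfolding sup_semilattice_in_cone_order_def by blast
  then show ?case by simp
next
  case (Suc n)
  then obtain y where y: "y \<in> D" "\<forall>j\<le>n. cone_le C (x j) y"
    "\<And>w. w \<in> D \<Longrightarrow> \<forall>j\<le>n. cone_le C (x j) w \<Longrightarrow> cone_le C y w"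
    by blast
  obtain z where z: "z \<in> D" "cone_le C y z" "cone_le C (x (Suc n)) z"
    "\<And>w. w \<in> D \<Longrightarrow> cone_le C y w \<Longrightarrow> cone_le C (x (Suc n)) w \<Longrightarrow> cone_le C z w"
    using sup x[of "Suc n"] y(1) unfolding sup_semilattice_in_cone_order_def by blast
  have "\<forall>j\<le>Suc n. cone_le C (x j) z"
    using z(3) cone_le_trans[OF C _ z(2)] y(2) by (auto simp: le_Suc_eq)
  moreover have "cone_le C z w" if "w \<in> D" "\<forall>j\<le>Suc n. cone_le C (x j) w" for w
    using that y(3) z(4) by simp
  ultimately show ?case using z(1) by blast
qed

text \<open>Let \<open>g = h / r\<close> and let \<open>z\<close> be the supremum of
  \<open>(g ^^ j) x\<close> over \<open>j < m\<close>. Then \<open>g z\<close> bounds these vectors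
  shifted by one; the shifted family ends with \<open>(g ^^ m) x \<ge> x\<close>, so
  \<open>g z\<close> bounds the original family too, and leastness gives
  \<open>z \<le> g z\<close>.\<close>

lemma superharmonic_of_iterate:
  fixes C :: "'a::real_normed_vector set"
  assumes C: "proper_cone C" and sup: "sup_semilattice_in_cone_order C C"
    and h: "h \<in> C \<rightarrow> C" "homogeneous_on C h" "cone_order_preserving C h"
    and r: "0 < r" and m: "0 < m" and x: "x \<in> C - {0}" "cone_le C (r ^ m *\<^sub>R x) ((h ^^ m) x)"
  shows "\<exists>z\<in>C - {0}. cone_le C (r *\<^sub>R z) (h z)"
proof -
  have cC: "cone C" "convex C" and pt: "C \<inter> uminus ` C = {0}"
    using C by (auto simp: proper_cone_def)
  define g where "g = (\<lambda>x. (1 / r) *\<^sub>R h x)"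
  have g: "g \<in> C \<rightarrow> C" "cone_order_preserving C g"
    unfolding g_def using scaled_map[OF cC(1) _ h(1), of "1 / r"] r h by auto
  have xC: "x \<in> C" using x by simp
  have gk: "(g ^^ k) x \<in> C" for k by (rule funpow_in[OF g(1) xC])
  have "(g ^^ m) x = (1 / r) ^ m *\<^sub>R (h ^^ m) x"
    unfolding g_def by (rule funpow_scaled_map[OF h(1,2) _ xC]) (use r in simp)
  then have xm: "cone_le C x ((g ^^ m) x)"
    using cone_le_scaleR[OF cC(1) _ x(2), of "(1 / r) ^ m"] r by (simp add: power_divide)
  \<comment> \<open>The finite supremum is indexed by \<open>j \<le> n\<close>, which is the range
    \<open>j < m\<close>.\<close>
  obtain n where n: "m = Suc n" using m by (cases m) auto
  obtain z where z: "z \<in> C" "\<forall>j\<le>n. cone_le C ((g ^^ j) x) z"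
    "\<And>w. w \<in> C \<Longrightarrow> \<forall>j\<le>n. cone_le C ((g ^^ j) x) w \<Longrightarrow> cone_le C z w"
    using sup_semilattice_finite_sup[OF cC sup, of "\<lambda>k. (g ^^ k) x" n] gk by blast
  have gz: "cone_le C ((g ^^ Suc j) x) (g z)" if "j \<le> n" for j
    using g(2) gk z that by (simp add: cone_order_preserving_def)
  have "cone_le C ((g ^^ j) x) (g z)" if "j \<le> n" for j
  proof (cases j)
    case 0
    then show ?thesis using cone_le_trans[OF cC xm] gz[of n] n by simp
  next
    case (Suc i)
    then show ?thesis using gz[of i] that by simp
  qed
  then have "cone_le C z (g z)" using z(1,3) g(1) by blast
  then have "cone_le C (r *\<^sub>R z) (h z)"
    using cone_le_scaleR[OF cC(1), of r z "g z"] r by (simp add: g_def)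
  moreover have "z \<noteq> 0"
  proof
    assume "z = 0"
    then have "- x \<in> C" using z(2) by (auto simp: cone_le_def dest: spec[of _ 0])
    then have "x \<in> C \<inter> uminus ` C" using xC image_eqI[of x uminus "- x"] by simp
    then show False using pt x by auto
  qed
  ultimately show ?thesis using z(1) by blast
qed

section \<open>Eigenvectors from bounded increasing orbits\<close>

text \<open>Beyond its first \<open>m\<close> terms the orbit \<open>a\<close> of
  \<open>g = h / r\<close> is the image of itself under \<open>g ^^ m\<close>, which contracts
  \<open>\<nu>\<close>; so it is relatively compact. Being increasing, it has a single cluster
  point, and continuity makes this point fixed under \<open>g\<close>.\<close>

lemma increasing_orbit_has_eigenvector:
  fixes C :: "'a::real_normed_vector set"
  assumes \<nu>: "homogeneous_generalized_mnc \<nu>" and C: "proper_cone C"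
    and h: "h \<in> C \<rightarrow> C" "continuous_on C h" "homogeneous_on C h" "cone_order_preserving C h"
    and r: "0 < r" and m: "0 < m" and \<mu>: "\<mu> < r ^ m"
      "\<And>A. bounded A \<Longrightarrow> A \<subseteq> C \<Longrightarrow> \<nu> ((h ^^ m) ` A) \<le> \<mu> * \<nu> A"
    and x: "x \<in> C - {0}" "cone_le C (r *\<^sub>R x) (h x)"
      "bounded (range (\<lambda>k. (1 / r ^ k) *\<^sub>R (h ^^ k) x))"
  shows "\<exists>y\<in>C - {0}. h y = r *\<^sub>R y"
proof -
  have cC: "cone C" "closed C" "convex C" and pt: "C \<inter> uminus ` C = {0}"
    using C by (auto simp: proper_cone_def)
  have antisym: "a = b" if "cone_le C a b" "cone_le C b a" for a b
  proof -
    have "b - a \<in> C \<inter> uminus ` C"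
      using that image_eqI[of "b - a" uminus "a - b"] by (simp add: cone_le_def)
    then show ?thesis using pt by auto
  qed
  define g where "g = (\<lambda>x. (1 / r) *\<^sub>R h x)"
  have g: "g \<in> C \<rightarrow> C" "cone_order_preserving C g"
    unfolding g_def using scaled_map[OF cC(1) _ h(1), of "1 / r"] r h by auto
  have xC: "x \<in> C" using x by simp
  define a where "a k = (g ^^ k) x" for k
  have aC: "a k \<in> C" for k unfolding a_def by (rule funpow_in[OF g(1) xC])
  have a_pow: "(g ^^ k) y = (1 / r) ^ k *\<^sub>R (h ^^ k) y" if "y \<in> C" for k y
    unfolding g_def by (rule funpow_scaled_map[OF h(1,3) _ that]) (use r in simp)
  have ba: "bounded (range a)"
    using x(3) a_pow[OF xC] by (simp add: a_def[abs_def] power_divide)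
  have AC: "range a \<subseteq> C" using aC by auto
  have le_Suc: "cone_le C (a k) (a (Suc k))" for k
  proof (induction k)
    case 0
    then show ?case
      using cone_le_scaleR[OF cC(1) _ x(2), of "1 / r"] r by (simp add: a_def g_def)
  next
    case (Suc k)
    then show ?case using g(2) aC[of k] aC[of "Suc k"] by (simp add: cone_order_preserving_def a_def)
  qed
  have refl: "cone_le C b b" for b using pt by (auto simp: cone_le_def)
  have le: "cone_le C (a j) (a k)" if "j \<le> k" for j k
    using that by (induction k rule: dec_induct) (use refl cone_le_trans[OF cC(1,3) _ le_Suc] in blast)+
  have "compact (closure (range a))"
  proof (rule compact_closure_if_mnc_contracted[OF \<nu> ba])
    show "compact (insert 0 (a ` {..<m}))"
      by (intro finite_imp_compact) simp
    have sub: "(g ^^ m) ` range a \<subseteq> range a"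
      by (auto simp: a_def simp flip: funpow_add[unfolded o_def, THEN fun_cong])
    show "bounded ((g ^^ m) ` range a)" using ba sub by (rule bounded_subset)
    show "range a \<subseteq> {c + b | c b. c \<in> insert 0 (a ` {..<m}) \<and> b \<in> convex hull (insert 0 ((g ^^ m) ` range a))}"
    proof
      fix v assume "v \<in> range a"
      then obtain k where k: "v = a k" by blast
      have *: "b \<in> convex hull (insert 0 ((g ^^ m) ` range a))" if "b \<in> insert 0 ((g ^^ m) ` range a)" for b
        using that by (rule hull_inc)
      show "v \<in> {c + b | c b. c \<in> insert 0 (a ` {..<m}) \<and> b \<in> convex hull (insert 0 ((g ^^ m) ` range a))}"
      proof (cases "k < m")
        case True
        then have "v = a k + 0" "a k \<in> insert 0 (a ` {..<m})" using k by auto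
        then show ?thesis using *[of 0] by blast
      next
        case False
        then have "a k = (g ^^ m) (a (k - m))"
          by (simp add: a_def flip: funpow_add[unfolded o_def, THEN fun_cong])
        then have "v = 0 + a k" "a k \<in> insert 0 ((g ^^ m) ` range a)" using k by auto
        then show ?thesis using *[of "a k"] by blast
      qed
    qed
    have hb: "bounded ((h ^^ m) ` range a)"
    proof -
      have "(h ^^ m) ` range a = (\<lambda>v. r ^ m *\<^sub>R v) ` (g ^^ m) ` range a"
        using a_pow[OF aC] r by (simp add: image_image power_divide)
      then show ?thesis using \<open>bounded ((g ^^ m) ` range a)\<close> by (simp add: bounded_scaling)
    qed
    have "\<nu> ((g ^^ m) ` range a) = (1 / r) ^ m * \<nu> ((h ^^ m) ` range a)"
      using mnc_scaleR[OF \<nu> hb, of "(1 / r) ^ m"] a_pow[OF aC] r by (simp add: image_image)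
    also have "\<dots> \<le> (1 / r) ^ m * (\<mu> * \<nu> (range a))"
      using \<mu>(2)[OF ba AC] r by (intro mult_left_mono) auto
    finally show "\<nu> ((g ^^ m) ` range a) \<le> (\<mu> / r ^ m) * \<nu> (range a)" by (simp add: power_divide)
    show "\<mu> / r ^ m < 1" using \<mu>(1) r by simp
  qed
  then have comp: "seq_compact (closure (range a))"
    by (simp add: compact_eq_seq_compact_metric)
  have in_cl: "a k \<in> closure (range a)" for k by (meson closure_subset rangeI subsetD)
  obtain l \<sigma> where l: "strict_mono \<sigma>" "(a \<circ> \<sigma>) \<longlonglongrightarrow> l"
    using comp in_cl unfolding seq_compact_def by metis
  have al: "(\<lambda>k. a (\<sigma> k)) \<longlonglongrightarrow> l" using l by (simp add: o_def)
  \<comment> \<open>A cluster point of the shifted subsequence. Once \<open>l = l'\<close> is known,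
    comparing the limits of \<open>a (Suc k)\<close> and of \<open>g (a k)\<close> along common
    indices yields the fixed point equation.\<close>
  obtain l' \<tau> where l': "strict_mono \<tau>" "((\<lambda>k. a (Suc (\<sigma> k))) \<circ> \<tau>) \<longlonglongrightarrow> l'"
    using comp in_cl unfolding seq_compact_def by metis
  have al': "(\<lambda>k. a (Suc (\<sigma> (\<tau> k)))) \<longlonglongrightarrow> l'" using l' by (simp add: o_def)
  have upper: "cone_le C (a j) p" if p: "(\<lambda>k. a (\<rho> k)) \<longlonglongrightarrow> p" and \<rho>: "filterlim \<rho> at_top sequentially" for j p \<rho>
  proof -
    have "\<forall>\<^sub>F k in sequentially. a (\<rho> k) - a j \<in> C"
      using \<rho> le unfolding filterlim_at_top cone_le_def by (blast intro: eventually_mono)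
    then show ?thesis
      unfolding cone_le_def
      by (intro Lim_in_closed_set[OF cC(2) _ _ tendsto_diff[OF p tendsto_const]]) auto
  qed
  have below: "cone_le C p b" if p: "(\<lambda>k. a (\<rho> k)) \<longlonglongrightarrow> p" and b: "\<And>j. cone_le C (a j) b" for p b \<rho>
    unfolding cone_le_def
    by (intro Lim_in_closed_set[OF cC(2) _ _ tendsto_diff[OF tendsto_const p]])
      (use b in \<open>auto simp: cone_le_def\<close>)
  have \<sigma>: "filterlim \<sigma> at_top sequentially" and \<tau>: "filterlim \<tau> at_top sequentially"
    using l(1) l'(1) by (auto intro: filterlim_subseq)
  have "filterlim (\<lambda>k. Suc (\<sigma> (\<tau> k))) at_top sequentially"
    by (intro filterlim_compose[OF filterlim_Suc] filterlim_compose[OF \<sigma> \<tau>])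
  \<comment> \<open>Each limit is an upper bound of the orbit by \<open>upper\<close> and lies below
    every upper bound by \<open>below\<close>, so the two are equal by antisymmetry.\<close>
  then have "l = l'"
    using below[OF al upper[OF al']] below[OF al' upper[OF al \<sigma>]] by (intro antisym)
  have lC: "l \<in> C" by (rule closed_sequentially[OF cC(2) _ al]) (use aC in auto)
  have "(\<lambda>k. a (\<sigma> (\<tau> k))) \<longlonglongrightarrow> l"
    using LIMSEQ_subseq_LIMSEQ[OF al l'(1)] by (simp add: o_def)
  then have "(\<lambda>k. h (a (\<sigma> (\<tau> k)))) \<longlonglongrightarrow> h l"
    by (intro continuous_on_tendsto_compose[OF h(2) _ lC]) (use aC in auto)
  then have "(\<lambda>k. (1 / r) *\<^sub>R h (a (\<sigma> (\<tau> k)))) \<longlonglongrightarrow> (1 / r) *\<^sub>R h l"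
    by (intro tendsto_intros)
  then have "(\<lambda>k. a (Suc (\<sigma> (\<tau> k)))) \<longlonglongrightarrow> (1 / r) *\<^sub>R h l"
    by (simp add: a_def g_def)
  from LIMSEQ_unique[OF this al'] have hl: "(1 / r) *\<^sub>R h l = l"
    by (simp add: \<open>l = l'\<close>)
  have "r *\<^sub>R ((1 / r) *\<^sub>R h l) = r *\<^sub>R l" by (simp only: hl)
  then have "h l = r *\<^sub>R l" using r by simp
  moreover have "l \<noteq> 0"
  proof
    assume "l = 0"
    then have "- x \<in> C" using upper[OF al \<sigma>, of 0] by (simp add: cone_le_def a_def)
    then have "cone_le C x 0" by (simp add: cone_le_def)
    moreover have "cone_le C 0 x" using xC by (simp add: cone_le_def)
    ultimately show False using antisym x(1) by blast
  qed
  ultimately show ?thesis using lC by blast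
qed

text \<open>An eigenvector has the orbit \<open>l ^ k x\<close>, whose \<open>k\<close>-th roots of
  norms tend to \<open>l\<close>. The case \<open>l = 0\<close> is separate because homogeneity
  concerns positive factors.\<close>

lemma eigenvalue_le_cone_spectral_radius:
  assumes "homogeneous_on C h" and x: "x \<in> C - {0}" "h x = l *\<^sub>R x" and l: "0 \<le> l"
  shows "ennreal l \<le> cone_spectral_radius C h"
proof (cases "l = 0")
  case False
  then have l: "0 < l" using l by simp
  have pow: "(h ^^ k) x = l ^ k *\<^sub>R x" for k
  proof (induction k)
    case (Suc k)
    have "h (l ^ k *\<^sub>R x) = l ^ k *\<^sub>R h x"
      using assms(1) x l by (simp add: homogeneous_on_def)
    then show ?case using Suc x by (simp add: mult.commute)
  qed simp
  have "(\<lambda>k. ennreal (l * root k (norm x))) \<longlonglongrightarrow> ennreal (l * 1)"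
    using x by (intro tendsto_intros LIMSEQ_root_const) auto
  moreover have "\<forall>\<^sub>F k in sequentially. ennreal (l * root k (norm x)) = ennreal (root k (norm ((h ^^ k) x)))"
    using eventually_gt_at_top[of 0]
    by eventually_elim (use l in \<open>simp add: pow real_root_mult real_root_power_cancel\<close>)
  ultimately have "(\<lambda>k. ennreal (root k (norm ((h ^^ k) x)))) \<longlonglongrightarrow> ennreal l"
    by (simp add: tendsto_cong)
  then have "limsup (\<lambda>k. ennreal (root k (norm ((h ^^ k) x)))) = ennreal l"
    by (simp add: lim_imp_Limsup)
  then show ?thesis
    using SUP_upper[of x C "\<lambda>x. limsup (\<lambda>k. ennreal (root k (norm ((h ^^ k) x))))"] x(1)
    by (simp add: cone_spectral_radius_def)
qed simp

section \<open>Subeigenvectors and eigenvectors at the cone spectral radius\<close>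

theorem theorem5p1:
  fixes C :: "'a::banach set" and h :: "'a \<Rightarrow> 'a" and \<nu> :: "'a set \<Rightarrow> real"
  assumes "homogeneous_generalized_mnc \<nu>"
    and "proper_cone C"
    and "sup_semilattice_in_cone_order C C"
    and "h \<in> C \<rightarrow> C"
    and "continuous_on C h"
    and "homogeneous_on C h"
    and "cone_order_preserving C h"
    and "cone_essential_spectral_radius \<nu> C h < cone_spectral_radius C h"
  shows "let r = enn2real (cone_spectral_radius C h) in
    (\<exists>z\<in>C - {0}. cone_le C (r *\<^sub>R z) (h z)) \<and>
    ((\<exists>\<zeta>\<in>C - {0}. cone_le C (r *\<^sub>R \<zeta>) (h \<zeta>) \<and>
         bounded (range (\<lambda>k. (1 / r ^ k) *\<^sub>R (h ^^ k) \<zeta>))) \<longrightarrow>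
       (\<exists>x\<in>C - {0}. h x = r *\<^sub>R x) \<and>
       cone_eigenvalue_spectral_radius C h = cone_spectral_radius C h)"
proof -
  note \<nu> = assms(1) and C = assms(2) and sup = assms(3) and h = assms(4-7)
  have cC: "cone C" "0 \<in> C" using C by (auto simp: proper_cone_def)
  define r where "r = enn2real (cone_spectral_radius C h)"
  \<comment> \<open>Finiteness makes the conversion to a real number lossless; positivity below
    holds since the radius strictly exceeds another element of \<open>ennreal\<close>.\<close>
  have r: "cone_spectral_radius C h = ennreal r"
    using cone_spectral_radius_finite[OF C h(1-3)] by (simp add: r_def)
  have "0 < cone_spectral_radius C h" using assms(8) by (rule le_less_trans[rotated]) simp
  then have r0: "0 < r" by (simp add: r)
  have "cone_essential_spectral_radius \<nu> C h < ennreal r" using assms(8) by (simp only: r)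
  then obtain m \<mu> where m: "0 < m" "0 < \<mu>" "\<mu> < r ^ m"
    "\<And>A. bounded A \<Longrightarrow> A \<subseteq> C \<Longrightarrow> \<nu> ((h ^^ m) ` A) \<le> \<mu> * \<nu> A"
    using r0 by (elim exists_contractive_iterate) auto
  have unb: "\<exists>u\<in>C. \<not> bounded (range (\<lambda>k. (1 / L) ^ k *\<^sub>R ((h ^^ m) ^^ k) u))"
    if L: "0 < L" "L < r ^ m" for L
  proof -
    \<comment> \<open>The growth statement is phrased for \<open>l < r\<close>; taking the
      \<open>m\<close>-th root turns the level \<open>L\<close> for \<open>h ^^ m\<close> into such
      an \<open>l\<close>.\<close>
    define l where "l = root m L"
    have Ll: "L = l ^ m" and l0: "0 < l" using L m by (simp_all add: l_def)
    have "l < r" using L(2) r0 unfolding Ll by (intro power_less_imp_less_base[of l m r]) auto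
    then have lr: "ennreal l < cone_spectral_radius C h" using l0 by (simp add: r ennreal_less_iff)
    show ?thesis
      using unbounded_scaled_orbit[OF cC h(1-3) l0 lr m(1)] unfolding Ll by blast
  qed
  obtain x where x: "x \<in> C" "norm x = 1" "(h ^^ m) x - r ^ m *\<^sub>R x \<in> C"
  proof (rule exists_superharmonic[OF \<nu> C _ _ _ _ m(2-4) unb])
    show "h ^^ m \<in> C \<rightarrow> C" using funpow_in[OF h(1)] by blast
  qed (use h in \<open>auto intro: continuous_on_funpow homogeneous_on_funpow cone_order_preserving_funpow\<close>)
  have part1: "\<exists>z\<in>C - {0}. cone_le C (r *\<^sub>R z) (h z)"
    using x by (intro superharmonic_of_iterate[OF C sup h(1,3,4) r0 m(1), of x])
      (auto simp: cone_le_def)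
  have part2: "(\<exists>x\<in>C - {0}. h x = r *\<^sub>R x) \<and>
      cone_eigenvalue_spectral_radius C h = cone_spectral_radius C h"
    if "\<zeta> \<in> C - {0}" "cone_le C (r *\<^sub>R \<zeta>) (h \<zeta>)"
      "bounded (range (\<lambda>k. (1 / r ^ k) *\<^sub>R (h ^^ k) \<zeta>))" for \<zeta>
  proof
    show eig: "\<exists>x\<in>C - {0}. h x = r *\<^sub>R x"
      by (rule increasing_orbit_has_eigenvector[OF \<nu> C h r0 m(1,3,4) that])
    show "cone_eigenvalue_spectral_radius C h = cone_spectral_radius C h"
    proof (rule antisym)
      show "cone_eigenvalue_spectral_radius C h \<le> cone_spectral_radius C h"
        unfolding cone_eigenvalue_spectral_radius_def
        by (rule Sup_least) (auto intro!: eigenvalue_le_cone_spectral_radius[OF h(3)])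
      \<comment> \<open>The eigenvector just found makes \<open>r\<close> a member of the set whose
        supremum is taken.\<close>
      show "cone_spectral_radius C h \<le> cone_eigenvalue_spectral_radius C h"
        unfolding cone_eigenvalue_spectral_radius_def r
        using eig r0 by (intro Sup_upper) (auto intro!: exI[of _ r])
    qed
  qed
  show ?thesis
    unfolding Let_def r_def[symmetric] using part1 part2 by blast
qed

end
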